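(* Let $k\geq 0$ and $l\geq 1$ be integers and let $T_0,\dots,T_k$ be integer matrices, where $T_s$ has $l$ rows and $n_s\geq 1$ columns. Then the set $\mathcal{H}_{k,\infty}$ of building blocks of the Graver bases of the matrices $A_{k,N}$, $N\geq 1$, is finite.
   Context: For $N\geq 1$ put $A_{0,N}:=T_0$, and for $s=1,\dots,k$ let $$A_{s,N}:=\begin{pmatrix} T_{s,N} & A_{s-1,N} & 0 & \cdots & 0\\ T_{s,N} & 0 & A_{s-1,N} & \cdots & 0\\ \vdots & \vdots & \vdots & \ddots & \vdots\\ T_{s,N} & 0 & 0 & \cdots & A_{s-1,N}\end{pmatrix}$$ with $N$ block rows, where $T_{s,N}$ is the vertical stack of $N^{s-1}$ copies of $T_s$. The matrix $A_{s,N}$ has $N^s l$ rows and $d_{s,N}=\sum_{i=0}^s N^{s-i}n_i$ columns. On $\mathbb{Z}^d$ define $a\sqsubseteq b$ iff $a_jb_j\geq 0$ and $|a_j|\leq|b_j|$ for all $j$. The Graver basis $G(A)$ of an integer matrix $A$ with $d$ columns is the set of $\sqsubseteq$-minimal non-zero elements of $\{z\in\mathbb{Z}^d: Az=0\}$. Building blocks: let $[1,N]=\{1,\dots,N\}$, and let $\varepsilon$ be the empty sequence, so $[1,N]^0=\{\varepsilon\}$. A vector $z\in\mathbb{Z}^{d_{h,N}}$ is decomposed into blocks $z_\alpha\in\mathbb{Z}^{n_{h-s}}$, for $\alpha\in[1,N]^s$, $s=0,\dots,h$, following the recursive block structure of the columns of $A_{h,N}$: $z_\varepsilon\in\mathbb{Z}^{n_h}$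 consists of the first $n_h$ coordinates, and if $h>0$ the remaining coordinates form $N$ consecutive vectors $z_{(1)},\dots,z_{(N)}\in\mathbb{Z}^{d_{h-1,N}}$ such that the block of $z$ with index $(i,\alpha_2,\dots,\alpha_s)$ is the block of $z_{(i)}$ with index $(\alpha_2,\dots,\alpha_s)$. Put $$\mathcal{H}_{k,N}^s:=\{z_\alpha: z\in G(A_{k,N}),\ \alpha\in[1,N]^s\}\subseteq\mathbb{Z}^{n_{k-s}}\quad(s=0,\dots,k),$$ $\mathcal{H}^s_{k,\infty}:=\bigcup_{N\geq 1}\mathcal{H}_{k,N}^s$, and let $\mathcal{H}_{k,\infty}:=\bigcup_{s=0}^k\mathcal{H}_{k,\infty}^s$ (disjoint union). *)

theory Defs
  imports "Jordan_Normal_Form.Matrix_Kernel"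
begin

definition vstack :: "nat \<Rightarrow> int mat \<Rightarrow> int mat" where
  "vstack m M = mat (m * dim_row M) (dim_col M) (\<lambda>(i, j). M $$ (i mod dim_row M, j))"

text \<open>
  \<open>A_mat T N s\<close> is the matrix $A_{s,N}$ built from $T_0, \dots, T_s$.  All block rows of
  $A_{s,N}$ have the same left block, the stack of $N^{s-1}$ copies of $T_s$.  The two
  lower blocks of the \<open>four_block_mat\<close> have no rows, so that the upper two are just
  put side by side.
\<close>

fun A_mat :: "(nat \<Rightarrow> int mat) \<Rightarrow> nat \<Rightarrow> nat \<Rightarrow> int mat" where
  "A_mat T N 0 = T 0"
| "A_mat T N (Suc s) =
     (let L = vstack N (vstack (N ^ s) (T (Suc s)));
          D = diag_block_mat (replicate N (A_mat T N s))
      in four_block_mat L D (0\<^sub>m 0 (dim_col L)) (0\<^sub>m 0 (dim_col D)))"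

definition d_cols :: "(nat \<Rightarrow> nat) \<Rightarrow> nat \<Rightarrow> nat \<Rightarrow> nat" where
  "d_cols n N s = (\<Sum>i\<le>s. N ^ (s - i) * n i)"

lemma dim_vstack [simp]:
  "dim_row (vstack m M) = m * dim_row M" "dim_col (vstack m M) = dim_col M"
  by (simp_all add: vstack_def)

lemma d_cols_0 [simp]: "d_cols n N 0 = n 0"
  by (simp add: d_cols_def)

lemma d_cols_Suc: "d_cols n N (Suc s) = n (Suc s) + N * d_cols n N s"
proof -
  have "(\<Sum>i\<le>s. N ^ (Suc s - i) * n i) = N * (\<Sum>i\<le>s. N ^ (s - i) * n i)"
    unfolding sum_distrib_left by (rule sum.cong) (auto simp: Suc_diff_le)
  then show ?thesis
    by (simp add: d_cols_def)
qed

lemma A_mat_carrier: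
  assumes "\<And>i. i \<le> s \<Longrightarrow> T i \<in> carrier_mat l (n i)"
  shows "A_mat T N s \<in> carrier_mat (N ^ s * l) (d_cols n N s)"
  using assms
proof (induction s)
  case (Suc s)
  then have "A_mat T N s \<in> carrier_mat (N ^ s * l) (d_cols n N s)"
    "T (Suc s) \<in> carrier_mat l (n (Suc s))"
    by auto
  then show ?case
    by (auto simp: Let_def dim_diag_block_mat d_cols_Suc sum_list_replicate)
qed simp

definition conformal_le :: "int vec \<Rightarrow> int vec \<Rightarrow> bool" (infix \<open>\<sqsubseteq>\<^sub>c\<close> 50) where
  "a \<sqsubseteq>\<^sub>c b \<longleftrightarrow> dim_vec a = dim_vec b \<and>
     (\<forall>j < dim_vec b. a $ j * b $ j \<ge> 0 \<and> \<bar>a $ j\<bar> \<le> \<bar>b $ j\<bar>)"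

definition Graver_basis :: "int mat \<Rightarrow> int vec set" where
  "Graver_basis A =
     {z \<in> mat_kernel A - {0\<^sub>v (dim_col A)}.
        \<forall>w \<in> mat_kernel A - {0\<^sub>v (dim_col A)}. w \<sqsubseteq>\<^sub>c z \<longrightarrow> w = z}"

text \<open>
  \<open>block n N h \<alpha> z\<close> is the block $z_\alpha$ of $z \in \mathbb{Z}^{d_{h,N}}$.  It is meant
  for index lists of length at most \<open>h\<close> with entries in \<open>{1..N}\<close>.
\<close>

fun block :: "(nat \<Rightarrow> nat) \<Rightarrow> nat \<Rightarrow> nat \<Rightarrow> nat list \<Rightarrow> int vec \<Rightarrow> int vec" where
  "block n N h [] z = vec_first z (n h)"
| "block n N (Suc h) (i # \<alpha>) z =
     block n N h \<alpha>
       (vec (d_cols n N h) (\<lambda>j. z $ (n (Suc h) + (i - 1) * d_cols n N h + j)))"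
| "block n N 0 (i # \<alpha>) z = undefined"

definition H_fin :: "(nat \<Rightarrow> int mat) \<Rightarrow> nat \<Rightarrow> nat \<Rightarrow> nat \<Rightarrow> int vec set" where
  "H_fin T k N s =
     {block (\<lambda>i. dim_col (T i)) N k \<alpha> z | z \<alpha>.
        z \<in> Graver_basis (A_mat T N k) \<and> set \<alpha> \<subseteq> {1..N} \<and> length \<alpha> = s}"

definition H_level :: "(nat \<Rightarrow> int mat) \<Rightarrow> nat \<Rightarrow> nat \<Rightarrow> int vec set" where
  "H_level T k s = (\<Union>N\<in>{1..}. H_fin T k N s)"

text \<open>The disjoint union over the levels: every building block is tagged with its level.\<close>

definition H_inf :: "(nat \<Rightarrow> int mat) \<Rightarrow> nat \<Rightarrow> (nat \<times> int vec) set" where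
  "H_inf T k = (SIGMA s:{0..k}. H_level T k s)"

end

theory Submission
  imports Defs "HOL-Library.Function_Algebras"
begin

text \<open>
  All entries of all elements of the Graver bases of $A_{k,N}$ are bounded by a constant that
  does not depend on $N$ (lemmas \<open>balanced_minimal_bounded\<close> and
  \<open>kernel_minimal_bounded\<close>); this bounds the entries of the building blocks, which have fixed
  lengths, so there are only finitely many of them.

  For the bound, a vector is seen as a tree whose nodes carry the building blocks.  It lies in
  the kernel iff for each leaf the sum of $T_s z_\alpha$ along the path from the root to this
  leaf vanishes.  Call a vector balanced if all leaves have the same path sum.  Balanced vectors
  form a group, and each is a sum of $\sqsubseteq$-minimal ones without cancellation.  The
  minimal ones are shown to be bounded by induction on the depth.  Since the root adds the same
  summand to all path sums, a minimal balanced vector is, up to sign, a unit vector at the root,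
  or it vanishes there.  In the second case its children are balanced and have the same path sum $b$.
  Decompose each child into minimal balanced vectors: they are bounded by induction, so that
  their path sums lie in a finite set $D$ that does not depend on $N$.

  The heart of the matter is now \<open>bounded_common_subsum\<close>: given any number of multisets over
  $D$ with the same sum $b \neq 0$, one can choose in each of them a sub-multiset of bounded
  size such that all sub-multisets have the same sum $b' \neq 0$, where the bound depends on
  $D$ only.  Applied to the path sums of the parts of each child, this selects from every child a
  bounded part such that the selected parts together are again balanced; by minimality nothing
  is left over.  If $b = 0$, a single child can be isolated, and it is minimal in the kernel;
  kernel elements are treated in the same way, with \<open>bounded_zero_subsum\<close> for a single
  multiset.  Both statements on sub-sums rest on Dickson's lemma.
\<close>

section \<open>Dickson's lemma\<close>

lemma nat_seq_mono_subseq: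
  fixes s :: "nat \<Rightarrow> nat"
  shows "\<exists>r :: nat \<Rightarrow> nat. strict_mono r \<and> mono (s \<circ> r)"
proof -
  obtain r :: "nat \<Rightarrow> nat" where r: "strict_mono r" "monoseq (s \<circ> r)"
    using seq_monosub[of s] by (auto simp: o_def)
  show ?thesis
  proof (cases "incseq (s \<circ> r)")
    case True
    then show ?thesis using r(1) by blast
  next
    case False
    then have dec: "decseq (s \<circ> r)"
      using r(2) by (auto simp: monoseq_iff)
    \<comment> \<open>A decreasing sequence of natural numbers is constant once it has reached its minimum.\<close>
    obtain m where m: "\<And>i. s (r m) \<le> s (r i)"
      using ex_has_least_nat[of "\<lambda>_. True" 0 "s \<circ> r"] by auto
    have "s (r (m + i)) = s (r m)" for i
      using m[of "m + i"] decseqD[OF dec, of m "m + i"] by simp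
    then have "mono (s \<circ> (\<lambda>i. r (m + i)))"
      by (simp add: mono_def)
    moreover have "strict_mono (\<lambda>i. r (m + i))"
      using r(1) by (simp add: strict_mono_def)
    ultimately show ?thesis by blast
  qed
qed

text \<open>
  Pass to a subsequence once for each coordinate; monotone coordinates stay monotone.
\<close>

lemma Dickson_mono_subseq:
  fixes f :: "nat \<Rightarrow> 'i \<Rightarrow> nat"
  assumes "finite I"
  shows "\<exists>r :: nat \<Rightarrow> nat. strict_mono r \<and> (\<forall>x\<in>I. mono (\<lambda>i. f (r i) x))"
  using assms
proof (induction I)
  case empty
  have "strict_mono (id :: nat \<Rightarrow> nat)"
    by (simp add: strict_mono_def)
  then show ?case by blast
next
  case (insert y I)
  then obtain r :: "nat \<Rightarrow> nat" where r: "strict_mono r" "\<And>x. x \<in> I \<Longrightarrow> mono (\<lambda>i. f (r i) x)"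
    by blast
  obtain q :: "nat \<Rightarrow> nat" where q: "strict_mono q" "mono ((\<lambda>i. f (r i) y) \<circ> q)"
    using nat_seq_mono_subseq by blast
  have "mono (\<lambda>i. f (r (q i)) x)" if "x \<in> insert y I" for x
    using that q(2) r(2)[of x] strict_mono_mono[OF q(1)]
    by (auto simp: o_def mono_def)
  moreover have "strict_mono (\<lambda>i. r (q i))"
    using r(1) q(1) by (simp add: strict_mono_def)
  ultimately show ?case by blast
qed

lemma Dickson:
  fixes f :: "nat \<Rightarrow> 'i \<Rightarrow> nat"
  assumes "finite I"
  shows "\<exists>i j. i < j \<and> (\<forall>x\<in>I. f i x \<le> f j x)"
proof -
  obtain r :: "nat \<Rightarrow> nat" where r: "strict_mono r" "\<And>x. x \<in> I \<Longrightarrow> mono (\<lambda>i. f (r i) x)"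
    using Dickson_mono_subseq[OF assms] by blast
  have "r 0 < r 1" "\<forall>x\<in>I. f (r 0) x \<le> f (r 1) x"
    using r by (auto simp: strict_mono_def dest: monoD)
  then show ?thesis by blast
qed

lemma subset_msetI_count:
  assumes "set_mset A \<subseteq> D" "\<And>d. d \<in> D \<Longrightarrow> count A d \<le> count B d"
  shows "A \<subseteq># B"
  using assms by (metis count_inI mset_subset_eqI subsetD zero_le)

text \<open>
  Dickson's lemma says that the minimal members of a set of multisets over a finite ground
  set are finitely many; all that is needed later is that their sizes are bounded.
\<close>

lemma bounded_minimal_submultisets:
  fixes U :: "'a multiset set"
  assumes "finite D" and "\<And>M. M \<in> U \<Longrightarrow> set_mset M \<subseteq> D"
  shows "\<exists>K. \<forall>M\<in>U. \<exists>M'\<in>U. M' \<subseteq># M \<and> size M' \<le> K"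
proof -
  define V where "V = {M \<in> U. \<forall>M'\<in>U. M' \<subseteq># M \<longrightarrow> M' = M}"
  have "finite V"
  proof (rule ccontr)
    assume "infinite V"
    then obtain e :: "nat \<Rightarrow> 'a multiset" where e: "inj e" "range e \<subseteq> V"
      using infinite_countable_subset by blast
    obtain i j where ij: "i < j" "\<forall>x\<in>D. count (e i) x \<le> count (e j) x"
      using Dickson[OF assms(1), of "\<lambda>i. count (e i)"] by blast
    have "e i \<in> V" "e j \<in> V"
      using e(2) by auto
    then have "e i \<subseteq># e j" "e i \<in> U"
      using ij(2) assms(2) unfolding V_def by (auto intro!: subset_msetI_count)
    then have "e i = e j"
      using \<open>e j \<in> V\<close> unfolding V_def by blast
    then show False
      using e(1) ij(1) by (auto dest: injD)
  qed
  have below: "\<exists>M'\<in>V. M' \<subseteq># M" if "M \<in> U" for M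
    using that
  proof (induction "size M" arbitrary: M rule: less_induct)
    case less
    show ?case
    proof (cases "M \<in> V")
      case False
      then obtain M' where "M' \<in> U" "M' \<subset># M"
        using less.prems unfolding V_def by (auto simp: subset_mset.less_le)
      moreover from this obtain M'' where "M'' \<in> V" "M'' \<subseteq># M'"
        using less.hyps[of M'] mset_subset_size by blast
      ultimately show ?thesis
        by (meson subset_mset.less_imp_le subset_mset.order_trans)
    qed auto
  qed
  have "\<forall>M\<in>V. size M \<le> Max (size ` V)"
    using \<open>finite V\<close> by simp
  then show ?thesis
    using below unfolding V_def by (metis (no_types, lifting) mem_Collect_eq)
qed

section \<open>Bounded sub-sums of multisets in an abelian group\<close>

text \<open>
  The case of a single multiset; here the common value of the sub-sums, \<open>0\<close>, is known in
  advance, so the minimal non-empty zero-sum multisets give the bound.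
\<close>

lemma bounded_zero_subsum:
  fixes D :: "'g::ab_group_add set"
  assumes "finite D"
  shows "\<exists>K. \<forall>M. set_mset M \<subseteq> D \<and> M \<noteq> {#} \<and> \<Sum>\<^sub># M = 0 \<longrightarrow>
           (\<exists>M'. M' \<subseteq># M \<and> M' \<noteq> {#} \<and> size M' \<le> K \<and> \<Sum>\<^sub># M' = 0)"
proof -
  let ?U = "{M. set_mset M \<subseteq> D \<and> M \<noteq> {#} \<and> \<Sum>\<^sub># M = 0}"
  have "\<And>M. M \<in> ?U \<Longrightarrow> set_mset M \<subseteq> D"
    by blast
  from bounded_minimal_submultisets[OF assms this] obtain K
    where K: "\<forall>M\<in>?U. \<exists>M'\<in>?U. M' \<subseteq># M \<and> size M' \<le> K"
    by blast
  show ?thesis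
  proof (intro exI[of _ K] allI impI)
    fix M assume "set_mset M \<subseteq> D \<and> M \<noteq> {#} \<and> \<Sum>\<^sub># M = 0"
    then have "M \<in> ?U" by simp
    then obtain M' where "M' \<in> ?U" "M' \<subseteq># M" "size M' \<le> K"
      using K by blast
    then show "\<exists>M'. M' \<subseteq># M \<and> M' \<noteq> {#} \<and> size M' \<le> K \<and> \<Sum>\<^sub># M' = 0"
      by blast
  qed
qed

text \<open>
  The plan for several multisets with a common sum \<open>b\<close> is to ignore, in each of them, the
  multiplicities from some threshold \<open>m\<close> on: elements that occur that often may be removed
  freely as long as at most \<open>m\<close> copies of each are needed.
\<close>

definition submonoid_sums :: "'g::comm_monoid_add set \<Rightarrow> 'g set" where
  "submonoid_sums S = {\<Sum>\<^sub># M | M. set_mset M \<subseteq> S}"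

definition frequent :: "nat \<Rightarrow> 'a set \<Rightarrow> 'a multiset \<Rightarrow> 'a set" where
  "frequent m D M = {d \<in> D. m \<le> count M d}"

definition frequent_sets :: "nat \<Rightarrow> 'g::comm_monoid_add set \<Rightarrow> 'g \<Rightarrow> 'g set set" where
  "frequent_sets m D b = {frequent m D M | M. set_mset M \<subseteq> D \<and> \<Sum>\<^sub># M = b}"

text \<open>
  Suppose that infinitely many \<open>b\<close> had the property; infinitely many of them share the same
  family of frequent sets.  For every \<open>b\<close> and every set \<open>S\<close> of this family fix a multiset
  with sum \<open>b\<close> and frequent set \<open>S\<close>.  Dickson's lemma, applied to all these multisets
  at once, finds two distinct values \<open>b\<close>, \<open>b'\<close> such that each multiset for \<open>b'\<close> is
  obtained from the corresponding one for \<open>b\<close> by adding elements of \<open>S\<close> only.  Then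
  \<open>b' - b \<noteq> 0\<close> is a sum over \<open>S\<close> for every \<open>S\<close> in the family.
\<close>

lemma finite_trivial_intersection:
  fixes D :: "'g::ab_group_add set"
  assumes "finite D"
  shows "finite {b. (\<Inter>S\<in>frequent_sets m D b. submonoid_sums S) \<subseteq> {0}}"
    (is "finite ?B")
proof (rule ccontr)
  assume inf: "infinite ?B"
  have "frequent_sets m D ` ?B \<subseteq> Pow (Pow D)"
    by (auto simp: frequent_sets_def frequent_def)
  then have "finite (frequent_sets m D ` ?B)"
    by (rule finite_subset) (simp add: assms)
  then obtain b0 where b0: "b0 \<in> ?B"
    "infinite {b \<in> ?B. frequent_sets m D b = frequent_sets m D b0}" (is "infinite ?B0")
    using pigeonhole_infinite[OF inf] by blast
  define SS where "SS = frequent_sets m D b0"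
  obtain e :: "nat \<Rightarrow> 'g" where e: "inj e" "range e \<subseteq> ?B0"
    using infinite_countable_subset[OF b0(2)] by blast
  define M where "M = (\<lambda>i S. SOME M. set_mset M \<subseteq> D \<and> \<Sum>\<^sub># M = e i \<and> frequent m D M = S)"
  have M: "set_mset (M i S) \<subseteq> D \<and> \<Sum>\<^sub># (M i S) = e i \<and> frequent m D (M i S) = S"
    if "S \<in> SS" for i S
  proof -
    have "S \<in> frequent_sets m D (e i)"
      using e(2) that unfolding SS_def by blast
    then have "\<exists>M. set_mset M \<subseteq> D \<and> \<Sum>\<^sub># M = e i \<and> frequent m D M = S"
      unfolding frequent_sets_def by blast
    then show ?thesis
      unfolding M_def by (rule someI_ex)
  qed
  \<comment> \<open>Comparing also the complements \<open>m - count\<close> forces equality of the multiplicities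
    below \<open>m\<close>.\<close>
  define f where "f = (\<lambda>i (S, d, up). if up then count (M i S) d else m - count (M i S) d)"
  have "finite (Pow D \<times> D \<times> (UNIV :: bool set))"
    using assms by simp
  from Dickson[OF this, of f] obtain i j where "i < j"
    and le_f: "\<forall>x\<in>Pow D \<times> D \<times> UNIV. f i x \<le> f j x"
    by blast
  have f_le: "f i (S, d, up) \<le> f j (S, d, up)" if "S \<subseteq> D" "d \<in> D" for S d up
    by (rule bspec[OF le_f]) (simp add: that)
  have "e j - e i \<in> submonoid_sums S" if S: "S \<in> SS" for S
  proof -
    have SD: "S \<subseteq> D"
      using S unfolding SS_def frequent_sets_def frequent_def by blast
    have le: "count (M i S) d \<le> count (M j S) d" if "d \<in> D" for d
      using f_le[OF SD that, of True] by (simp add: f_def)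
    then have sub: "M i S \<subseteq># M j S"
      using M[OF S] by (intro subset_msetI_count[of _ D]) auto
    have "count (M i S) d = count (M j S) d" if "d \<in> D" "d \<notin> S" for d
    proof -
      have "d \<notin> frequent m D (M j S)"
        using M[OF S, of j] that(2) by simp
      then have "count (M j S) d < m"
        using that(1) by (simp add: frequent_def)
      then show ?thesis
        using f_le[OF SD that(1), of False] le[OF that(1)] by (simp add: f_def)
    qed
    moreover have "set_mset (M j S - M i S) \<subseteq> D"
      using M[OF S, of j] by (auto dest: in_diffD)
    ultimately have "set_mset (M j S - M i S) \<subseteq> S"
      by (metis in_diff_count nat_less_le subset_iff)
    moreover have "\<Sum>\<^sub># (M j S - M i S) = e j - e i"
    proof -
      have "\<Sum>\<^sub># (M j S - M i S) + \<Sum>\<^sub># (M i S) = \<Sum>\<^sub># (M j S)"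
        unfolding sum_mset.union[symmetric] using sub by simp
      then show ?thesis
        using M[OF S, of i] M[OF S, of j] by (simp add: eq_diff_eq)
    qed
    ultimately show ?thesis
      unfolding submonoid_sums_def by (intro CollectI exI[of _ "M j S - M i S"]) simp
  qed
  moreover have "(\<Inter>S\<in>SS. submonoid_sums S) \<subseteq> {0}"
    using b0(1) unfolding SS_def by blast
  ultimately have "e j - e i = 0"
    by blast
  then show False
    using e(1) \<open>i < j\<close> by (auto dest: injD)
qed

text \<open>
  The number \<open>K\<close> depends on \<open>D\<close> only, and \<open>b'\<close> on \<open>D\<close> and \<open>b\<close> only, so
  arbitrarily many multisets with the same sum \<open>b\<close> have sub-multisets of bounded size
  with the same sum \<open>b'\<close>.
  
  Reason: for each of the finitely many families of subsets of \<open>D\<close> whose submonoids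
  share a non-zero element, choose such an element and a representation of it in each of these
  submonoids, and let \<open>m\<close> bound the sizes of all representations chosen.  If the frequent
  sets of the multisets with sum \<open>b\<close> form such a family, its chosen element serves as
  \<open>b'\<close>, since frequent elements occur at least \<open>m\<close> times.  Only finitely many other
  \<open>b\<close> exist by the preceding lemma, and for those \<open>b' = b\<close> works, with a bound given by
  the minimal multisets of sum \<open>b\<close>.
\<close>

theorem bounded_common_subsum:
  fixes D :: "'g::ab_group_add set"
  assumes "finite D"
  shows "\<exists>K. \<forall>b. b \<noteq> 0 \<longrightarrow> (\<exists>b'. b' \<noteq> 0 \<and> (\<forall>M. set_mset M \<subseteq> D \<and> \<Sum>\<^sub># M = b \<longrightarrow>
           (\<exists>M'. M' \<subseteq># M \<and> size M' \<le> K \<and> \<Sum>\<^sub># M' = b')))"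
proof -
  define sub where "sub = (\<lambda>b b' K. \<forall>M. set_mset M \<subseteq> D \<and> \<Sum>\<^sub># M = b \<longrightarrow>
    (\<exists>M'. M' \<subseteq># M \<and> size M' \<le> K \<and> \<Sum>\<^sub># M' = b'))"
  have sub_mono: "sub b b' K'" if "sub b b' K" "K \<le> K'" for b b' K K'
    unfolding sub_def
  proof (intro allI impI)
    fix M assume "set_mset M \<subseteq> D \<and> \<Sum>\<^sub># M = b"
    then obtain M' where "M' \<subseteq># M" "size M' \<le> K" "\<Sum>\<^sub># M' = b'"
      using \<open>sub b b' K\<close> unfolding sub_def by blast
    then show "\<exists>M'. M' \<subseteq># M \<and> size M' \<le> K' \<and> \<Sum>\<^sub># M' = b'"
      using \<open>K \<le> K'\<close> by (intro exI[of _ M']) simp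
  qed
  define X :: "'g set set \<Rightarrow> 'g set" where "X = (\<lambda>SS. \<Inter>S\<in>SS. submonoid_sums S)"
  define G where "G = {SS. SS \<subseteq> Pow D \<and> \<not> X SS \<subseteq> {0}}"
  have fin: "finite (G \<times> Pow D)"
    unfolding G_def using assms by simp
  have "\<exists>w. w \<noteq> 0 \<and> w \<in> X SS" if "SS \<in> G" for SS
    using that unfolding G_def by blast
  then obtain w where w: "\<And>SS. SS \<in> G \<Longrightarrow> w SS \<noteq> 0" "\<And>SS. SS \<in> G \<Longrightarrow> w SS \<in> X SS"
    by metis
  define W where "W = (\<lambda>SS S. SOME M. set_mset M \<subseteq> S \<and> \<Sum>\<^sub># M = w SS)"
  have W: "set_mset (W SS S) \<subseteq> S \<and> \<Sum>\<^sub># (W SS S) = w SS" if "SS \<in> G" "S \<in> SS" for SS S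
  proof -
    have "w SS \<in> submonoid_sums S"
      using w(2)[OF that(1)] that(2) unfolding X_def by blast
    then have "\<exists>M. set_mset M \<subseteq> S \<and> \<Sum>\<^sub># M = w SS"
      unfolding submonoid_sums_def by auto
    then show ?thesis
      unfolding W_def by (rule someI_ex)
  qed
  define m where "m = Max (insert 0 ((\<lambda>(SS, S). size (W SS S)) ` (G \<times> Pow D)))"
  have size_W: "size (W SS S) \<le> m" if "SS \<in> G" "S \<in> SS" for SS S
  proof -
    have "(SS, S) \<in> G \<times> Pow D"
      using that unfolding G_def by blast
    from imageI[OF this, of "\<lambda>(SS, S). size (W SS S)"]
    have "size (W SS S) \<in> (\<lambda>(SS, S). size (W SS S)) ` (G \<times> Pow D)"
      by simp
    then show ?thesis
      unfolding m_def by (intro Max_ge) (simp_all only: fin finite_insert finite_imageI insert_iff simp_thms)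
  qed
  \<comment> \<open>The exceptional sums, for which \<open>b\<close> itself will serve as the common value.\<close>
  define B where "B = {b. X (frequent_sets m D b) \<subseteq> {0}}"
  have finB: "finite B"
    unfolding B_def X_def by (rule finite_trivial_intersection[OF assms])
  have "\<exists>K. sub b b K" for b
  proof -
    let ?U = "{M. set_mset M \<subseteq> D \<and> \<Sum>\<^sub># M = b}"
    have "\<And>M. M \<in> ?U \<Longrightarrow> set_mset M \<subseteq> D"
      by blast
    from bounded_minimal_submultisets[OF assms this] obtain K
      where K: "\<forall>M\<in>?U. \<exists>M'\<in>?U. M' \<subseteq># M \<and> size M' \<le> K"
      by blast
    have "sub b b K"
      unfolding sub_def
    proof (intro allI impI)
      fix M assume "set_mset M \<subseteq> D \<and> \<Sum>\<^sub># M = b"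
      then have "M \<in> ?U" by simp
      then obtain M' where "M' \<in> ?U" "M' \<subseteq># M" "size M' \<le> K"
        using K by blast
      then show "\<exists>M'. M' \<subseteq># M \<and> size M' \<le> K \<and> \<Sum>\<^sub># M' = b"
        by blast
    qed
    then show ?thesis ..
  qed
  then obtain Kb where Kb: "\<And>b. sub b b (Kb b)"
    by metis
  define K where "K = Max (insert m (Kb ` B))"
  have "m \<le> K" and KB: "\<And>b. b \<in> B \<Longrightarrow> Kb b \<le> K"
    unfolding K_def using finB by auto
  have "\<exists>b'. b' \<noteq> 0 \<and> sub b b' K" if "b \<noteq> 0" for b
  proof (cases "b \<in> B")
    case True
    then show ?thesis
      using sub_mono[OF Kb KB] that by blast
  next
    case False
    let ?SS = "frequent_sets m D b"
    have "?SS \<subseteq> Pow D"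
      unfolding frequent_sets_def frequent_def by blast
    then have SS: "?SS \<in> G"
      using False unfolding B_def G_def by blast
    have "sub b (w ?SS) m"
      unfolding sub_def
    proof (intro allI impI)
      fix M assume M: "set_mset M \<subseteq> D \<and> \<Sum>\<^sub># M = b"
      have S: "frequent m D M \<in> ?SS"
        unfolding frequent_sets_def using M by (intro CollectI exI[of _ M]) simp
      let ?W = "W ?SS (frequent m D M)"
      have "count ?W d \<le> count M d" if "d \<in> frequent m D M" for d
        using that size_W[OF SS S] count_le_size[of ?W d] unfolding frequent_def by simp
      then have "?W \<subseteq># M"
        using W[OF SS S] by (intro subset_msetI_count[of _ "frequent m D M"]) simp_all
      then show "\<exists>M'. M' \<subseteq># M \<and> size M' \<le> m \<and> \<Sum>\<^sub># M' = w ?SS"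
        using W[OF SS S] size_W[OF SS S] by (intro exI[of _ ?W]) simp
    qed
    then show ?thesis
      using w(1)[OF SS] sub_mono \<open>m \<le> K\<close> by blast
  qed
  then show ?thesis
    unfolding sub_def by (intro exI[of _ K] allI impI)
qed

section \<open>Conformal decomposition\<close>

text \<open>
  Vectors are functions, of which only the values on an index set \<open>I\<close> matter: equality and
  vanishing are understood on \<open>I\<close> throughout.
\<close>

definition conformal_on :: "'i set \<Rightarrow> ('i \<Rightarrow> int) \<Rightarrow> ('i \<Rightarrow> int) \<Rightarrow> bool" where
  "conformal_on I a b \<longleftrightarrow> (\<forall>j\<in>I. 0 \<le> a j * b j \<and> \<bar>a j\<bar> \<le> \<bar>b j\<bar>)"

definition conformal_minimal ::
    "'i set \<Rightarrow> (('i \<Rightarrow> int) \<Rightarrow> bool) \<Rightarrow> ('i \<Rightarrow> int) \<Rightarrow> bool" where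
  "conformal_minimal I P z \<longleftrightarrow> P z \<and> (\<exists>j\<in>I. z j \<noteq> 0) \<and>
     (\<forall>w. P w \<and> (\<exists>j\<in>I. w j \<noteq> 0) \<and> conformal_on I w z \<longrightarrow> (\<forall>j\<in>I. w j = z j))"

lemma conformal_on_refl: "conformal_on I a a"
  by (simp add: conformal_on_def)

lemma int_conformal_trans:
  fixes x y z :: int
  assumes "0 \<le> x * y" "\<bar>x\<bar> \<le> \<bar>y\<bar>" "0 \<le> y * z" "\<bar>y\<bar> \<le> \<bar>z\<bar>"
  shows "0 \<le> x * z" "\<bar>x\<bar> \<le> \<bar>z\<bar>"
  using assms by (auto simp: zero_le_mult_iff)

lemma conformal_on_trans:
  "conformal_on I a b \<Longrightarrow> conformal_on I b c \<Longrightarrow> conformal_on I a c"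
  unfolding conformal_on_def by (meson int_conformal_trans)

lemma int_conformal_diff:
  fixes w z :: int
  assumes "0 \<le> w * z" "\<bar>w\<bar> \<le> \<bar>z\<bar>"
  shows "0 \<le> (z - w) * z" "\<bar>z - w\<bar> \<le> \<bar>z\<bar>" "\<bar>z\<bar> = \<bar>w\<bar> + \<bar>z - w\<bar>"
  using assms by (auto simp: zero_le_mult_iff abs_if split: if_splits)

text \<open>
  A vector that is not minimal itself is the sum of a smaller vector of the group and the
  remainder; both are conformal to it and have smaller \<open>\<ell>\<^sub>1\<close>-norm.
\<close>

lemma conformal_decomposition:
  assumes "finite I" and diff: "\<And>a b. P a \<Longrightarrow> P b \<Longrightarrow> P (\<lambda>j. a j - b j)" and "P z"
  shows "\<exists>M. (\<forall>g\<in>#M. conformal_minimal I P g \<and> conformal_on I g z) \<and>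
             (\<forall>j\<in>I. z j = (\<Sum>g\<in>#M. g j))"
  using assms(3)
proof (induction "nat (\<Sum>j\<in>I. \<bar>z j\<bar>)" arbitrary: z rule: less_induct)
  case less
  consider "\<forall>j\<in>I. z j = 0" | "conformal_minimal I P z"
    | w where "P w" "\<exists>j\<in>I. w j \<noteq> 0" "conformal_on I w z" "\<exists>j\<in>I. w j \<noteq> z j"
    using less.prems unfolding conformal_minimal_def by blast
  then show ?case
  proof cases
    case 1
    then show ?thesis by (intro exI[of _ "{#}"]) simp
  next
    case 2
    then show ?thesis by (intro exI[of _ "{#z#}"]) (simp add: conformal_on_refl)
  next
    case 3
    define u where "u = (\<lambda>j. z j - w j)"
    have "P u"
      unfolding u_def using diff less.prems 3(1) by blast
    have uz: "conformal_on I u z"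
      using 3(3) unfolding conformal_on_def u_def by (meson int_conformal_diff)
    have sum: "(\<Sum>j\<in>I. \<bar>z j\<bar>) = (\<Sum>j\<in>I. \<bar>w j\<bar>) + (\<Sum>j\<in>I. \<bar>u j\<bar>)"
      unfolding sum.distrib[symmetric]
      using 3(3) unfolding conformal_on_def u_def by (intro sum.cong) (auto intro: int_conformal_diff(3))
    have "0 < (\<Sum>j\<in>I. \<bar>w j\<bar>)"
      using 3(2) assms(1) by (meson abs_ge_zero sum_pos2 zero_less_abs_iff)
    moreover have "0 < (\<Sum>j\<in>I. \<bar>u j\<bar>)"
    proof -
      obtain j where "j \<in> I" "u j \<noteq> 0"
        using 3(4) unfolding u_def by auto
      then show ?thesis
        using assms(1) by (meson abs_ge_zero sum_pos2 zero_less_abs_iff)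
    qed
    ultimately have less_norm: "nat (\<Sum>j\<in>I. \<bar>w j\<bar>) < nat (\<Sum>j\<in>I. \<bar>z j\<bar>)"
        "nat (\<Sum>j\<in>I. \<bar>u j\<bar>) < nat (\<Sum>j\<in>I. \<bar>z j\<bar>)"
      using sum by auto
    obtain M1 where M1: "\<forall>g\<in>#M1. conformal_minimal I P g \<and> conformal_on I g w"
        "\<forall>j\<in>I. w j = (\<Sum>g\<in>#M1. g j)"
      using less.hyps[OF less_norm(1) 3(1)] by blast
    obtain M2 where M2: "\<forall>g\<in>#M2. conformal_minimal I P g \<and> conformal_on I g u"
        "\<forall>j\<in>I. u j = (\<Sum>g\<in>#M2. g j)"
      using less.hyps[OF less_norm(2) \<open>P u\<close>] by blast
    have "\<forall>g\<in>#M1 + M2. conformal_minimal I P g \<and> conformal_on I g z"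
      using M1(1) M2(1) conformal_on_trans[OF _ 3(3)] conformal_on_trans[OF _ uz] by auto
    moreover have "\<forall>j\<in>I. z j = (\<Sum>g\<in>#M1 + M2. g j)"
    proof
      fix j assume "j \<in> I"
      then show "z j = (\<Sum>g\<in>#M1 + M2. g j)"
        using M1(2) M2(2) unfolding u_def by fastforce
    qed
    ultimately show ?thesis by blast
  qed
qed

lemma int_conformal_subsum:
  fixes z :: int
  assumes "\<And>g. g \<in># B \<Longrightarrow> 0 \<le> f g * z" "\<And>g. g \<in># B \<Longrightarrow> \<bar>f g\<bar> \<le> \<bar>z\<bar>" and "A \<subseteq># B"
  shows "0 \<le> (\<Sum>g\<in>#A. f g) * (\<Sum>g\<in>#B. f g)" "\<bar>\<Sum>g\<in>#A. f g\<bar> \<le> \<bar>\<Sum>g\<in>#B. f g\<bar>"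
proof -
  have nonneg: "0 \<le> (\<Sum>g\<in>#C. h g)" if "\<And>g. g \<in># C \<Longrightarrow> 0 \<le> h g" for C and h :: "'a \<Rightarrow> int"
    using that by (induction C) auto
  have neg: "(\<Sum>g\<in>#C. - h g) = - (\<Sum>g\<in>#C. h g)" for C and h :: "'a \<Rightarrow> int"
    by (induction C) auto
  obtain C where B: "B = A + C"
    using assms(3) by (metis subset_mset.add_diff_inverse)
  have "(\<forall>g\<in>#B. 0 \<le> f g) \<or> (\<forall>g\<in>#B. 0 \<le> - f g)"
    using assms(1,2) by (cases "0 < z"; cases "z = 0") (auto simp: zero_le_mult_iff)
  then have "0 \<le> (\<Sum>g\<in>#A. f g) \<and> 0 \<le> (\<Sum>g\<in>#C. f g) \<or>
      (\<Sum>g\<in>#A. f g) \<le> 0 \<and> (\<Sum>g\<in>#C. f g) \<le> 0"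
  proof
    assume "\<forall>g\<in>#B. 0 \<le> - f g"
    then have "0 \<le> (\<Sum>g\<in>#A. - f g)" "0 \<le> (\<Sum>g\<in>#C. - f g)"
      unfolding B by (auto intro!: nonneg)
    then show ?thesis
      by (simp_all add: neg)
  qed (auto simp: B intro!: nonneg)
  then show "0 \<le> (\<Sum>g\<in>#A. f g) * (\<Sum>g\<in>#B. f g)" "\<bar>\<Sum>g\<in>#A. f g\<bar> \<le> \<bar>\<Sum>g\<in>#B. f g\<bar>"
    unfolding B by (auto simp: zero_le_mult_iff)
qed

text \<open>
  All summands lie in the orthant of \<open>z\<close>, so no cancellation takes place in either sum.
\<close>

lemma conformal_on_subsum:
  assumes "\<And>g. g \<in># B \<Longrightarrow> conformal_on I g z" and "A \<subseteq># B"
  shows "conformal_on I (\<lambda>j. \<Sum>g\<in>#A. g j) (\<lambda>j. \<Sum>g\<in>#B. g j)"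
  unfolding conformal_on_def
proof
  fix j assume "j \<in> I"
  then show "0 \<le> (\<Sum>g\<in>#A. g j) * (\<Sum>g\<in>#B. g j) \<and> \<bar>\<Sum>g\<in>#A. g j\<bar> \<le> \<bar>\<Sum>g\<in>#B. g j\<bar>"
    using int_conformal_subsum[OF _ _ assms(2), of "\<lambda>g. g j" "z j"] assms(1)
    unfolding conformal_on_def by blast
qed

lemma conformal_on_nonzero:
  assumes "conformal_on I g z" "\<exists>j\<in>I. g j \<noteq> 0"
  shows "\<exists>j\<in>I. z j \<noteq> 0"
  using assms unfolding conformal_on_def by (metis abs_le_zero_iff abs_zero)

lemma abs_sum_mset_le:
  fixes C :: nat
  assumes "\<And>g. g \<in># M \<Longrightarrow> \<bar>f g\<bar> \<le> int C"
  shows "\<bar>\<Sum>g\<in>#M. f g\<bar> \<le> int (size M * C)"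
  using assms
proof (induction M)
  case (add g M)
  have "\<bar>f g\<bar> \<le> int C" "\<bar>\<Sum>g\<in>#M. f g\<bar> \<le> int (size M * C)"
    using add by auto
  then show ?case by (simp add: algebra_simps)
qed simp

section \<open>Uniform bounds for balanced vectors\<close>

text \<open>
  A vector with \<open>d_cols n N h\<close> coordinates is regarded as a tree of depth \<open>h\<close> in which
  every inner node has \<open>N\<close> children: the root carries the first \<open>n h\<close> coordinates, the
  children the subsequent segments of length \<open>d_cols n N (h - 1)\<close>.  The map \<open>L s\<close> stands
  for multiplication by \<open>T\<^sub>s\<close>; the argument needs only that it is additive, takes values in
  an abelian group and depends on the first \<open>n s\<close> coordinates.
\<close>

locale multistage =
  fixes n :: "nat \<Rightarrow> nat" and L :: "nat \<Rightarrow> (nat \<Rightarrow> int) \<Rightarrow> 'g::ab_group_add"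
  assumes L_add: "L s (\<lambda>j. a j + b j) = L s a + L s b"
    and L_cong: "(\<And>j. j < n s \<Longrightarrow> a j = b j) \<Longrightarrow> L s a = L s b"
begin

definition child :: "nat \<Rightarrow> nat \<Rightarrow> nat \<Rightarrow> (nat \<Rightarrow> int) \<Rightarrow> nat \<Rightarrow> int" where
  "child N h i z = (\<lambda>j. z (n (Suc h) + i * d_cols n N h + j))"

text \<open>
  The sum of the values \<open>L s\<close> along the path from the root to the first leaf.  It is used for
  balanced vectors, where all leaves give the same sum; this needs \<open>N \<ge> 1\<close>, since index
  \<open>0\<close> is not a child otherwise.
\<close>

primrec leaf :: "nat \<Rightarrow> nat \<Rightarrow> (nat \<Rightarrow> int) \<Rightarrow> 'g" where
  "leaf N 0 z = L 0 z"
| "leaf N (Suc h) z = L (Suc h) z + leaf N h (child N h 0 z)"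

text \<open>
  All leaves have the same path sum, but it need not be \<open>0\<close>.  Unlike the kernel condition,
  this one passes to the subtrees: a kernel vector has path sum \<open>0\<close> from its root, and its
  subtrees have path sums that only agree with each other.
\<close>

primrec balanced :: "nat \<Rightarrow> nat \<Rightarrow> (nat \<Rightarrow> int) \<Rightarrow> bool" where
  "balanced N 0 z \<longleftrightarrow> True"
| "balanced N (Suc h) z \<longleftrightarrow> (\<forall>i<N. balanced N h (child N h i z) \<and>
     leaf N h (child N h i z) = leaf N h (child N h 0 z))"

text \<open>As a rewrite rule, the equation for \<open>leaf\<close> in this clause loops on child \<open>0\<close>.\<close>

declare balanced.simps(2) [simp del]

lemma balanced_SucI:
  assumes "\<And>i. i < N \<Longrightarrow> balanced N h (child N h i z)"
    and "\<And>i. i < N \<Longrightarrow> leaf N h (child N h i z) = b"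
  shows "balanced N (Suc h) z"
proof -
  have "leaf N h (child N h i z) = leaf N h (child N h 0 z)" if "i < N" for i
    using assms(2)[OF that] assms(2)[of 0] that by simp
  then show ?thesis
    unfolding balanced.simps using assms(1) by blast
qed

lemma balanced_SucD:
  assumes "balanced N (Suc h) z" "i < N"
  shows "balanced N h (child N h i z)" "leaf N h (child N h i z) = leaf N h (child N h 0 z)"
  using assms unfolding balanced.simps by blast+

text \<open>
  The tree with zero root and children \<open>w 0, \<dots>, w (N - 1)\<close>.
\<close>

definition glue :: "nat \<Rightarrow> nat \<Rightarrow> (nat \<Rightarrow> nat \<Rightarrow> int) \<Rightarrow> nat \<Rightarrow> int" where
  "glue N h w = (\<lambda>p. if p < n (Suc h) then 0
     else w ((p - n (Suc h)) div d_cols n N h) ((p - n (Suc h)) mod d_cols n N h))"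

lemma child_index_less:
  assumes "i < N" "j < d_cols n N h"
  shows "n (Suc h) + i * d_cols n N h + j < d_cols n N (Suc h)"
proof -
  have "i * d_cols n N h + j < Suc i * d_cols n N h"
    using assms(2) by simp
  also have "\<dots> \<le> N * d_cols n N h"
    using assms(1) by (intro mult_le_mono1) simp
  finally show ?thesis
    by (simp add: d_cols_Suc)
qed

lemma index_cases:
  assumes "p < d_cols n N (Suc h)"
  obtains "p < n (Suc h)"
  | i j where "i < N" "j < d_cols n N h" "p = n (Suc h) + i * d_cols n N h + j"
proof (cases "p < n (Suc h)")
  case False
  let ?d = "d_cols n N h" and ?q = "p - n (Suc h)"
  have q: "?q < N * ?d"
    using assms False by (simp add: d_cols_Suc)
  then have "0 < ?d"
    by (cases "?d = 0") auto
  then have "?q div ?d < N" "?q mod ?d < ?d"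
    using q by (auto simp: less_mult_imp_div_less)
  moreover have "p = n (Suc h) + ?q div ?d * ?d + ?q mod ?d"
    using False by simp
  ultimately show ?thesis
    using that(2) by blast
qed (rule that(1))

lemma child_glue: "j < d_cols n N h \<Longrightarrow> child N h i (glue N h w) j = w i j"
  by (simp add: child_def glue_def)

lemma L_finite_range: "finite {L s z | z. \<forall>j<n s. \<bar>z j\<bar> \<le> c}"
proof (rule finite_subset)
  show "finite (L s ` ({..<n s} \<rightarrow>\<^sub>E {-c..c}))"
    by (simp add: finite_PiE)
  show "{L s z | z. \<forall>j<n s. \<bar>z j\<bar> \<le> c} \<subseteq> L s ` ({..<n s} \<rightarrow>\<^sub>E {-c..c})"
  proof
    fix b assume "b \<in> {L s z | z. \<forall>j<n s. \<bar>z j\<bar> \<le> c}"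
    then obtain z where z: "b = L s z" "\<And>j. j < n s \<Longrightarrow> \<bar>z j\<bar> \<le> c"
      by blast
    have "b = L s (restrict z {..<n s})"
      unfolding z(1) by (rule L_cong) simp
    moreover have "- c \<le> z j \<and> z j \<le> c" if "j < n s" for j
      using z(2)[OF that] by linarith
    then have "restrict z {..<n s} \<in> {..<n s} \<rightarrow>\<^sub>E {-c..c}"
      by (simp add: PiE_iff)
    ultimately show "b \<in> L s ` ({..<n s} \<rightarrow>\<^sub>E {-c..c})"
      by (rule image_eqI)
  qed
qed

lemma leaf_cong:
  assumes "1 \<le> N" "\<And>j. j < d_cols n N h \<Longrightarrow> a j = b j"
  shows "leaf N h a = leaf N h b"
  using assms(2)
proof (induction h arbitrary: a b)
  case (Suc h)
  have "leaf N h (child N h 0 a) = leaf N h (child N h 0 b)"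
    unfolding child_def by (intro Suc.IH Suc.prems child_index_less) (use assms(1) in auto)
  moreover have "L (Suc h) a = L (Suc h) b"
    by (intro L_cong Suc.prems) (simp add: d_cols_Suc)
  ultimately show ?case by simp
qed (auto intro: L_cong)

lemma balanced_cong:
  assumes "1 \<le> N" "\<And>j. j < d_cols n N h \<Longrightarrow> a j = b j"
  shows "balanced N h a = balanced N h b"
  using assms(2)
proof (induction h arbitrary: a b)
  case (Suc h)
  have eq: "child N h i a j = child N h i b j" if "i < N" "j < d_cols n N h" for i j
    unfolding child_def by (intro Suc.prems child_index_less that)
  have "balanced N h (child N h i a) = balanced N h (child N h i b)" if "i < N" for i
    by (rule Suc.IH) (rule eq[OF that])
  moreover have "leaf N h (child N h i a) = leaf N h (child N h i b)" if "i < N" for i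
    by (rule leaf_cong[OF assms(1)]) (rule eq[OF that])
  moreover have "0 < N"
    using assms(1) by simp
  ultimately show ?case
    unfolding balanced.simps by metis
qed simp

lemma leaf_add: "leaf N h (\<lambda>j. a j + b j) = leaf N h a + leaf N h b"
  by (induction h arbitrary: a b) (simp_all add: L_add child_def)

lemma leaf_diff: "leaf N h (\<lambda>j. a j - b j) = leaf N h a - leaf N h b"
  using leaf_add[of N h "\<lambda>j. a j - b j" b] by simp

lemma leaf_zero: "leaf N h (\<lambda>j. 0) = 0"
  using leaf_add[of N h "\<lambda>j. 0" "\<lambda>j. 0"] by simp

lemma leaf_sum: "leaf N h (\<lambda>j. \<Sum>g\<in>#M. g j) = (\<Sum>g\<in>#M. leaf N h g)"
  by (induction M) (simp_all add: leaf_zero leaf_add)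

lemma balanced_add:
  "balanced N h a \<Longrightarrow> balanced N h b \<Longrightarrow> balanced N h (\<lambda>j. a j + b j)"
proof (induction h arbitrary: a b)
  case (Suc h)
  have child: "child N h i (\<lambda>j. a j + b j) = (\<lambda>j. child N h i a j + child N h i b j)" for i
    by (simp add: child_def)
  show ?case
  proof (rule balanced_SucI)
    fix i assume i: "i < N"
    show "balanced N h (child N h i (\<lambda>j. a j + b j))"
      unfolding child by (intro Suc.IH balanced_SucD(1)[OF _ i] Suc.prems)
    show "leaf N h (child N h i (\<lambda>j. a j + b j)) =
        leaf N h (child N h 0 a) + leaf N h (child N h 0 b)"
      unfolding child leaf_add by (simp only: Suc.prems[THEN balanced_SucD(2)[OF _ i]])
  qed
qed simp

lemma balanced_diff:
  "balanced N h a \<Longrightarrow> balanced N h b \<Longrightarrow> balanced N h (\<lambda>j. a j - b j)"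
proof (induction h arbitrary: a b)
  case (Suc h)
  have child: "child N h i (\<lambda>j. a j - b j) = (\<lambda>j. child N h i a j - child N h i b j)" for i
    by (simp add: child_def)
  show ?case
  proof (rule balanced_SucI)
    fix i assume i: "i < N"
    show "balanced N h (child N h i (\<lambda>j. a j - b j))"
      unfolding child by (intro Suc.IH balanced_SucD(1)[OF _ i] Suc.prems)
    show "leaf N h (child N h i (\<lambda>j. a j - b j)) =
        leaf N h (child N h 0 a) - leaf N h (child N h 0 b)"
      unfolding child leaf_diff by (simp only: Suc.prems[THEN balanced_SucD(2)[OF _ i]])
  qed
qed simp

lemma balanced_zero: "balanced N h (\<lambda>j. 0)"
proof (induction h)
  case (Suc h)
  then show ?case
    by (intro balanced_SucI[where b = 0]) (simp_all add: child_def leaf_zero)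
qed simp

lemma balanced_sum:
  "(\<And>g. g \<in># M \<Longrightarrow> balanced N h g) \<Longrightarrow> balanced N h (\<lambda>j. \<Sum>g\<in>#M. g j)"
  by (induction M) (simp_all add: balanced_zero balanced_add)

text \<open>
  The root contributes the same summand to every path, so it may be changed at will.
\<close>

lemma balanced_root_unit: "j0 < n h \<Longrightarrow> balanced N h (\<lambda>j. if j = j0 then c else 0)"
proof (cases h)
  case (Suc h')
  assume "j0 < n h"
  then have "child N h' i (\<lambda>j. if j = j0 then c else 0) = (\<lambda>j. 0)" for i
    unfolding child_def Suc by (intro ext) auto
  then show ?thesis
    unfolding Suc by (intro balanced_SucI[where b = 0]) (simp_all add: balanced_zero leaf_zero)
qed simp

text \<open>
  A path has only \<open>h + 1\<close> nodes, whatever \<open>N\<close> is; hence the union over all \<open>N\<close> is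
  still finite.
\<close>

lemma finite_leaf_values:
  "finite {leaf N h z | N z. 1 \<le> N \<and> (\<forall>j<d_cols n N h. \<bar>z j\<bar> \<le> c)}" (is "finite (?V h)")
proof (induction h)
  case 0
  have "?V 0 \<subseteq> {L 0 z | z. \<forall>j<n 0. \<bar>z j\<bar> \<le> c}"
    by auto
  then show ?case
    by (rule finite_subset) (rule L_finite_range)
next
  case (Suc h)
  let ?A = "{L (Suc h) z | z. \<forall>j<n (Suc h). \<bar>z j\<bar> \<le> c}"
  have "?V (Suc h) \<subseteq> (\<lambda>(a, b). a + b) ` (?A \<times> ?V h)"
  proof
    fix v assume "v \<in> ?V (Suc h)"
    then obtain N z where v: "v = leaf N (Suc h) z" "1 \<le> N"
      and z: "\<And>j. j < d_cols n N (Suc h) \<Longrightarrow> \<bar>z j\<bar> \<le> c"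
      by blast
    have "L (Suc h) z \<in> ?A"
      using z by (intro CollectI exI[of _ z]) (simp add: d_cols_Suc)
    moreover have "\<bar>child N h 0 z j\<bar> \<le> c" if "j < d_cols n N h" for j
      unfolding child_def by (intro z child_index_less that) (use v(2) in simp)
    then have "leaf N h (child N h 0 z) \<in> ?V h"
      using v(2) by blast
    ultimately show "v \<in> (\<lambda>(a, b). a + b) ` (?A \<times> ?V h)"
      unfolding v(1) by (intro image_eqI[where x = "(L (Suc h) z, leaf N h (child N h 0 z))"]) simp_all
  qed
  then show ?case
    by (rule finite_subset) (intro finite_imageI finite_cartesian_product L_finite_range Suc.IH)
qed

text \<open>
  The bound \<open>C\<close> is uniform in \<open>N\<close>, which is what makes the union of the Graver bases
  over all \<open>N\<close> tractable.
\<close>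

definition minimal_bounded :: "nat \<Rightarrow> (nat \<Rightarrow> (nat \<Rightarrow> int) \<Rightarrow> bool) \<Rightarrow> nat \<Rightarrow> bool" where
  "minimal_bounded h P C \<longleftrightarrow> (\<forall>N\<ge>1. \<forall>z. conformal_minimal {..<d_cols n N h} (P N) z \<longrightarrow>
     (\<forall>j<d_cols n N h. \<bar>z j\<bar> \<le> int C))"

definition leaf_kernel :: "nat \<Rightarrow> nat \<Rightarrow> (nat \<Rightarrow> int) \<Rightarrow> bool" where
  "leaf_kernel h N z \<longleftrightarrow> balanced N h z \<and> leaf N h z = 0"

lemma minimal_leaf_values:
  assumes "minimal_bounded h (\<lambda>N. balanced N h) C"
  obtains D where "finite D"
    "\<And>N g. 1 \<le> N \<Longrightarrow> conformal_minimal {..<d_cols n N h} (balanced N h) g \<Longrightarrow> leaf N h g \<in> D"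
proof
  show "finite {leaf N h z | N z. 1 \<le> N \<and> (\<forall>j<d_cols n N h. \<bar>z j\<bar> \<le> int C)}"
    by (rule finite_leaf_values)
  fix N g assume "1 \<le> N" "conformal_minimal {..<d_cols n N h} (balanced N h) g"
  then show "leaf N h g \<in> {leaf N h z | N z. 1 \<le> N \<and> (\<forall>j<d_cols n N h. \<bar>z j\<bar> \<le> int C)}"
    using assms unfolding minimal_bounded_def by blast
qed

lemma balanced_decomposition:
  assumes "1 \<le> N" "balanced N h z"
  obtains M where "\<And>g. g \<in># M \<Longrightarrow> conformal_minimal {..<d_cols n N h} (balanced N h) g"
    "\<And>g. g \<in># M \<Longrightarrow> conformal_on {..<d_cols n N h} g z"
    "\<And>j. j < d_cols n N h \<Longrightarrow> z j = (\<Sum>g\<in>#M. g j)"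
    "leaf N h z = (\<Sum>g\<in>#M. leaf N h g)"
proof -
  obtain M where M: "\<forall>g\<in>#M. conformal_minimal {..<d_cols n N h} (balanced N h) g \<and>
      conformal_on {..<d_cols n N h} g z" "\<forall>j\<in>{..<d_cols n N h}. z j = (\<Sum>g\<in>#M. g j)"
    using conformal_decomposition[of "{..<d_cols n N h}" "balanced N h" z] balanced_diff assms(2)
    by blast
  have "leaf N h z = leaf N h (\<lambda>j. \<Sum>g\<in>#M. g j)"
    using M(2) by (intro leaf_cong assms(1)) simp
  then have "leaf N h z = (\<Sum>g\<in>#M. leaf N h g)"
    by (simp only: leaf_sum)
  then show ?thesis
    using M by (intro that[of M]) auto
qed

text \<open>Sub-sums of the decomposition of a balanced vector, selected by their leaf values.\<close>

lemma balanced_subsum: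
  assumes "1 \<le> N" and bound: "minimal_bounded h (\<lambda>N. balanced N h) C"
    and min: "\<And>g. g \<in># M \<Longrightarrow> conformal_minimal {..<d_cols n N h} (balanced N h) g"
    and conf: "\<And>g. g \<in># M \<Longrightarrow> conformal_on {..<d_cols n N h} g z"
    and sum: "\<And>j. j < d_cols n N h \<Longrightarrow> z j = (\<Sum>g\<in>#M. g j)"
    and sub: "M' \<subseteq># image_mset (leaf N h) M" "size M' \<le> K"
  obtains w where "balanced N h w" "leaf N h w = \<Sum>\<^sub># M'"
    "conformal_on {..<d_cols n N h} w z"
    "\<And>j. j < d_cols n N h \<Longrightarrow> \<bar>w j\<bar> \<le> int (K * C)"
    "M' \<noteq> {#} \<Longrightarrow> \<exists>j<d_cols n N h. w j \<noteq> 0"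
proof -
  let ?I = "{..<d_cols n N h}"
  obtain R where "image_mset (leaf N h) M = M' + R"
    using sub(1) by (metis subset_mset.add_diff_inverse)
  then obtain A A' where A: "M = A + A'" "M' = image_mset (leaf N h) A"
    by (auto dest!: image_mset_eq_plusD)
  define w where "w = (\<lambda>j. \<Sum>g\<in>#A. g j)"
  have "balanced N h w"
    unfolding w_def using min A(1) by (intro balanced_sum) (auto simp: conformal_minimal_def)
  moreover have "leaf N h w = \<Sum>\<^sub># M'"
    unfolding w_def leaf_sum A(2) ..
  moreover have "conformal_on ?I w z"
  proof -
    have "conformal_on ?I w (\<lambda>j. \<Sum>g\<in>#M. g j)"
      unfolding w_def by (rule conformal_on_subsum[OF conf]) (simp_all add: A(1))
    then show ?thesis
      using sum by (simp add: conformal_on_def)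
  qed
  moreover have "\<bar>w j\<bar> \<le> int (K * C)" if "j < d_cols n N h" for j
  proof -
    have "\<bar>w j\<bar> \<le> int (size A * C)"
      unfolding w_def
    proof (rule abs_sum_mset_le)
      fix g assume "g \<in># A"
      then show "\<bar>g j\<bar> \<le> int C"
        using bound min[of g] that assms(1) A(1) unfolding minimal_bounded_def by simp
    qed
    also have "\<dots> \<le> int (K * C)"
      using sub(2) A(2) by (simp add: mult_right_mono)
    finally show ?thesis .
  qed
  moreover have "\<exists>j<d_cols n N h. w j \<noteq> 0" if "M' \<noteq> {#}"
  proof -
    obtain g where g: "g \<in># A"
      using \<open>M' \<noteq> {#}\<close> A(2) by fastforce
    have "conformal_on ?I (\<lambda>j. \<Sum>g\<in>#{#g#}. g j) w"
      unfolding w_def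
      by (rule conformal_on_subsum[OF conf]) (use g A(1) in auto)
    moreover have "\<exists>j\<in>?I. g j \<noteq> 0"
      using min[of g] g A(1) unfolding conformal_minimal_def by simp
    ultimately show ?thesis
      using conformal_on_nonzero[of ?I g w] by auto
  qed
  ultimately show ?thesis
    using that by blast
qed

text \<open>
  A kernel vector is a conformal sum of minimal balanced vectors.  Their path sums lie in a
  finite set and add up to \<open>0\<close>, so boundedly many of these summands already add up to a
  kernel vector; by minimality it is the whole vector.
\<close>

lemma kernel_minimal_bounded:
  assumes bound: "minimal_bounded h (\<lambda>N. balanced N h) C"
  shows "\<exists>C'. minimal_bounded h (leaf_kernel h) C'"
proof -
  obtain D where D: "finite D" "\<And>N g. 1 \<le> N \<Longrightarrow>
      conformal_minimal {..<d_cols n N h} (balanced N h) g \<Longrightarrow> leaf N h g \<in> D"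
    using minimal_leaf_values[OF bound] by metis
  obtain K where K: "\<And>M. set_mset M \<subseteq> D \<Longrightarrow> M \<noteq> {#} \<Longrightarrow> \<Sum>\<^sub># M = 0 \<Longrightarrow>
      \<exists>M'. M' \<subseteq># M \<and> M' \<noteq> {#} \<and> size M' \<le> K \<and> \<Sum>\<^sub># M' = 0"
    using bounded_zero_subsum[OF D(1)] by blast
  have "\<bar>z j\<bar> \<le> int (K * C)"
    if N: "1 \<le> N" and z: "conformal_minimal {..<d_cols n N h} (leaf_kernel h N) z"
      and j: "j < d_cols n N h" for N z j
  proof -
    have bal: "balanced N h z" and "leaf N h z = 0" and nz: "\<exists>j\<in>{..<d_cols n N h}. z j \<noteq> 0"
      using z unfolding conformal_minimal_def leaf_kernel_def by blast+
    obtain M where M: "\<And>g. g \<in># M \<Longrightarrow> conformal_minimal {..<d_cols n N h} (balanced N h) g"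
      "\<And>g. g \<in># M \<Longrightarrow> conformal_on {..<d_cols n N h} g z"
      "\<And>j. j < d_cols n N h \<Longrightarrow> z j = (\<Sum>g\<in>#M. g j)"
      "leaf N h z = (\<Sum>g\<in>#M. leaf N h g)"
      using balanced_decomposition[OF N bal] by blast
    have "set_mset (image_mset (leaf N h) M) \<subseteq> D"
      using D(2)[OF N] M(1) by auto
    moreover have "image_mset (leaf N h) M \<noteq> {#}"
      using nz M(3) by auto
    moreover have "\<Sum>\<^sub># (image_mset (leaf N h) M) = 0"
      using M(4) \<open>leaf N h z = 0\<close> by simp
    ultimately obtain M' where M': "M' \<subseteq># image_mset (leaf N h) M" "M' \<noteq> {#}"
        "size M' \<le> K" "\<Sum>\<^sub># M' = 0"
      using K by blast
    obtain w where w: "balanced N h w" "leaf N h w = \<Sum>\<^sub># M'"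
        "conformal_on {..<d_cols n N h} w z"
        "\<And>j. j < d_cols n N h \<Longrightarrow> \<bar>w j\<bar> \<le> int (K * C)"
        "M' \<noteq> {#} \<Longrightarrow> \<exists>j<d_cols n N h. w j \<noteq> 0"
      using balanced_subsum[OF N bound M(1-3) M'(1,3)] by blast
    have "leaf_kernel h N w" "\<exists>j\<in>{..<d_cols n N h}. w j \<noteq> 0"
      using w(1,2,5) M'(2,4) by (auto simp: leaf_kernel_def)
    then have "w j = z j"
      using z w(3) j unfolding conformal_minimal_def by blast
    then show ?thesis
      using w(4)[OF j] by simp
  qed
  then show ?thesis
    unfolding minimal_bounded_def by blast
qed

text \<open>
  To restrict the children of a minimal vector it suffices to exhibit vectors conformal to them
  that have a common path sum.
\<close>

lemma minimal_glue:
  assumes "1 \<le> N" and min: "conformal_minimal {..<d_cols n N (Suc h)} (balanced N (Suc h)) z"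
    and w: "\<And>i. i < N \<Longrightarrow> balanced N h (w i)" "\<And>i. i < N \<Longrightarrow> leaf N h (w i) = b"
      "\<And>i. i < N \<Longrightarrow> conformal_on {..<d_cols n N h} (w i) (child N h i z)"
      "\<exists>i<N. \<exists>j<d_cols n N h. w i j \<noteq> 0"
    and "i < N" "j < d_cols n N h"
  shows "child N h i z j = w i j"
proof -
  let ?I = "{..<d_cols n N (Suc h)}" and ?u = "glue N h w"
  have bal: "balanced N h (child N h i ?u)" and leaf: "leaf N h (child N h i ?u) = b"
    if "i < N" for i
    using w(1,2)[OF that] balanced_cong[OF assms(1), of h "child N h i ?u" "w i"]
      leaf_cong[OF assms(1), of h "child N h i ?u" "w i"] child_glue by simp_all
  have "balanced N (Suc h) ?u"
    using bal leaf by (rule balanced_SucI)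
  moreover have "conformal_on ?I ?u z"
    unfolding conformal_on_def
  proof
    fix p assume "p \<in> ?I"
    then have "p < d_cols n N (Suc h)" by simp
    then show "0 \<le> ?u p * z p \<and> \<bar>?u p\<bar> \<le> \<bar>z p\<bar>"
    proof (cases rule: index_cases)
      case 1
      then show ?thesis by (simp add: glue_def)
    next
      case (2 i j)
      have "?u p = w i j" "z p = child N h i z j"
        using child_glue[OF 2(2)] unfolding child_def 2(3) by simp_all
      then show ?thesis
        using w(3)[OF 2(1)] 2(2) unfolding conformal_on_def by simp
    qed
  qed
  moreover have "\<exists>p\<in>?I. ?u p \<noteq> 0"
  proof -
    obtain i j where ij: "i < N" "j < d_cols n N h" "w i j \<noteq> 0"
      using w(4) by blast
    then have "?u (n (Suc h) + i * d_cols n N h + j) \<noteq> 0"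
      using child_glue[of j N h i w] unfolding child_def by simp
    then show ?thesis
      using child_index_less[OF ij(1,2)] by blast
  qed
  ultimately have "\<forall>p\<in>?I. ?u p = z p"
    using min unfolding conformal_minimal_def by blast
  then have "child N h i ?u j = child N h i z j"
    using child_index_less[OF assms(7,8)] unfolding child_def by simp
  then show ?thesis
    using child_glue[OF assms(8)] by simp
qed

text \<open>
  A unit vector at the root is balanced and, with the right sign, conformal to \<open>z\<close>.
\<close>

lemma minimal_root_nonzero:
  assumes "conformal_minimal {..<d_cols n N h} (balanced N h) z" "j0 < n h"
    "n h \<le> d_cols n N h" "z j0 \<noteq> 0" "j < d_cols n N h"
  shows "\<bar>z j\<bar> \<le> 1"
proof -
  let ?I = "{..<d_cols n N h}" and ?u = "\<lambda>j. if j = j0 then sgn (z j0) else 0"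
  have "balanced N h ?u"
    by (rule balanced_root_unit[OF assms(2)])
  moreover have "conformal_on ?I ?u z"
    using assms(4) by (auto simp: conformal_on_def sgn_if)
  moreover have "j0 \<in> ?I"
    using assms(2,3) by simp
  then have "\<exists>j\<in>?I. ?u j \<noteq> 0"
    using assms(4) by (intro bexI[of _ j0]) (simp_all add: sgn_if)
  ultimately have "\<forall>j\<in>?I. ?u j = z j"
    using assms(1) unfolding conformal_minimal_def by blast
  then have "z j = ?u j"
    using assms(5) by simp
  then show ?thesis by (simp add: sgn_if)
qed

text \<open>
  If the common path sum of the children vanishes, each child can be varied on its own.
\<close>

lemma minimal_children_leaf_zero:
  assumes N: "1 \<le> N" and bound: "minimal_bounded h (leaf_kernel h) C"
    and min: "conformal_minimal {..<d_cols n N (Suc h)} (balanced N (Suc h)) z"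
    and zero: "leaf N h (child N h 0 z) = 0"
    and ij: "i < N" "j < d_cols n N h"
  shows "\<bar>child N h i z j\<bar> \<le> int C"
proof (cases "\<exists>j<d_cols n N h. child N h i z j \<noteq> 0")
  case True
  let ?J = "{..<d_cols n N h}"
  have ker: "leaf_kernel h N (child N h i z)"
    using balanced_SucD[OF _ ij(1)] min zero unfolding conformal_minimal_def leaf_kernel_def by simp
  have "\<forall>j\<in>?J. w' j = child N h i z j"
    if w': "leaf_kernel h N w'" "\<exists>j\<in>?J. w' j \<noteq> 0" "conformal_on ?J w' (child N h i z)" for w'
  proof
    fix j assume "j \<in> ?J"
    let ?w = "\<lambda>i'. if i' = i then w' else (\<lambda>j. 0)"
    have "child N h i z j = ?w i j"
    proof (rule minimal_glue[OF N min, where b = 0 and w = ?w])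
      show "\<exists>i'<N. \<exists>j<d_cols n N h. ?w i' j \<noteq> 0"
        using w'(2) ij(1) by (intro exI[of _ i]) auto
    qed (use w' ij(1) \<open>j \<in> ?J\<close> in
        \<open>auto simp: leaf_kernel_def balanced_zero leaf_zero conformal_on_def\<close>)
    then show "w' j = child N h i z j" by simp
  qed
  then have "conformal_minimal ?J (leaf_kernel h N) (child N h i z)"
    unfolding conformal_minimal_def using ker True by blast
  then show ?thesis
    using bound N ij(2) unfolding minimal_bounded_def by blast
qed (use ij(2) in auto)

text \<open>
  Induction on the depth.  In a minimal vector with zero root, the children have a common path
  sum \<open>b\<close>.  The case \<open>b = 0\<close> is covered by kernel vectors of smaller depth.  If
  \<open>b \<noteq> 0\<close>, decompose every child into minimal balanced vectors, which are bounded by the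
  induction hypothesis.  Their path sums form, for every child, a multiset over one finite set
  with sum \<open>b\<close>, so boundedly many summands can be selected from each child in such a way
  that the selected path sums have a common value \<open>b' \<noteq> 0\<close>.  The selections form a balanced
  vector below the given one and hence coincide with it.
\<close>

theorem balanced_minimal_bounded: "\<exists>C. minimal_bounded h (\<lambda>N. balanced N h) C"
proof (induction h)
  case 0
  have "\<bar>z j\<bar> \<le> int 1" if min: "conformal_minimal {..<d_cols n N 0} (balanced N 0) z"
    and j: "j < d_cols n N 0" for N z j
  proof -
    obtain j0 where "j0 < n 0" "z j0 \<noteq> 0"
      using min unfolding conformal_minimal_def by auto
    then show ?thesis
      using minimal_root_nonzero[OF min _ _ _ j] by simp
  qed
  then show ?case
    unfolding minimal_bounded_def by blast
next
  case (Suc h)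
  then obtain C where C: "minimal_bounded h (\<lambda>N. balanced N h) C" ..
  obtain C0 where C0: "minimal_bounded h (leaf_kernel h) C0"
    using kernel_minimal_bounded[OF C] ..
  obtain D where D: "finite D" "\<And>N g. 1 \<le> N \<Longrightarrow>
      conformal_minimal {..<d_cols n N h} (balanced N h) g \<Longrightarrow> leaf N h g \<in> D"
    using minimal_leaf_values[OF C] by metis
  obtain K where K: "\<forall>b. b \<noteq> 0 \<longrightarrow> (\<exists>b'. b' \<noteq> 0 \<and> (\<forall>M. set_mset M \<subseteq> D \<and> \<Sum>\<^sub># M = b \<longrightarrow>
           (\<exists>M'. M' \<subseteq># M \<and> size M' \<le> K \<and> \<Sum>\<^sub># M' = b')))"
    using bounded_common_subsum[OF D(1)] ..
  have "\<bar>z p\<bar> \<le> int (1 + C0 + K * C)"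
    if N: "1 \<le> N" and min: "conformal_minimal {..<d_cols n N (Suc h)} (balanced N (Suc h)) z"
      and p: "p < d_cols n N (Suc h)" for N z p
  proof (cases "\<exists>j0<n (Suc h). z j0 \<noteq> 0")
    case True
    then have "\<bar>z p\<bar> \<le> int 1"
      using minimal_root_nonzero[OF min _ _ _ p] by (auto simp: d_cols_Suc)
    also have "int 1 \<le> int (1 + C0 + K * C)"
      by (simp only: of_nat_le_iff)
    finally show ?thesis .
  next
    case False
    let ?J = "{..<d_cols n N h}" and ?b = "leaf N h (child N h 0 z)"
    have children: "\<bar>child N h i z j\<bar> \<le> int (C0 + K * C)"
      if ij: "i < N" "j < d_cols n N h" for i j
    proof (cases "?b = 0")
      case True
      then have "\<bar>child N h i z j\<bar> \<le> int C0"
        by (rule minimal_children_leaf_zero[OF N C0 min _ ij])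
      also have "int C0 \<le> int (C0 + K * C)"
        by (simp only: of_nat_le_iff)
      finally show ?thesis .
    next
      case False
      obtain b' where b': "b' \<noteq> 0 \<and> (\<forall>M. set_mset M \<subseteq> D \<and> \<Sum>\<^sub># M = ?b \<longrightarrow>
           (\<exists>M'. M' \<subseteq># M \<and> size M' \<le> K \<and> \<Sum>\<^sub># M' = b'))"
        using mp[OF spec[OF K] False] ..
      have "\<exists>w. balanced N h w \<and> leaf N h w = b' \<and> conformal_on ?J w (child N h i z) \<and>
          (\<forall>j<d_cols n N h. \<bar>w j\<bar> \<le> int (K * C))" if i: "i < N" for i
      proof -
        have bal: "balanced N h (child N h i z)" and lf: "leaf N h (child N h i z) = ?b"
          using balanced_SucD[OF _ i] min unfolding conformal_minimal_def by blast+
        obtain M where M: "\<And>g. g \<in># M \<Longrightarrow> conformal_minimal ?J (balanced N h) g"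
          "\<And>g. g \<in># M \<Longrightarrow> conformal_on ?J g (child N h i z)"
          "\<And>j. j < d_cols n N h \<Longrightarrow> child N h i z j = (\<Sum>g\<in>#M. g j)"
          "leaf N h (child N h i z) = (\<Sum>g\<in>#M. leaf N h g)"
          using balanced_decomposition[OF N bal] by blast
        have "set_mset (image_mset (leaf N h) M) \<subseteq> D"
          using D(2)[OF N] M(1) by auto
        moreover have "\<Sum>\<^sub># (image_mset (leaf N h) M) = ?b"
          using M(4) lf by simp
        ultimately obtain M' where M': "M' \<subseteq># image_mset (leaf N h) M" "size M' \<le> K"
            "\<Sum>\<^sub># M' = b'"
          using mp[OF spec[OF conjunct2[OF b']] conjI] by blast
        obtain w where "balanced N h w" "leaf N h w = \<Sum>\<^sub># M'"
            "conformal_on ?J w (child N h i z)"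
            "\<And>j. j < d_cols n N h \<Longrightarrow> \<bar>w j\<bar> \<le> int (K * C)"
          using balanced_subsum[OF N C M(1-3) M'(1,2)] by blast
        then show ?thesis
          using M'(3) by blast
      qed
      then obtain w where w: "\<And>i. i < N \<Longrightarrow> balanced N h (w i)"
          "\<And>i. i < N \<Longrightarrow> leaf N h (w i) = b'"
          "\<And>i. i < N \<Longrightarrow> conformal_on ?J (w i) (child N h i z)"
          "\<And>i j. i < N \<Longrightarrow> j < d_cols n N h \<Longrightarrow> \<bar>w i j\<bar> \<le> int (K * C)"
        by metis
      \<comment> \<open>A vector with path sum \<open>b' \<noteq> 0\<close> cannot vanish.\<close>
      have "\<exists>j<d_cols n N h. w 0 j \<noteq> 0"
      proof (rule ccontr)
        assume "\<not> ?thesis"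
        then have "leaf N h (w 0) = leaf N h (\<lambda>j. 0)"
          by (intro leaf_cong N) auto
        then show False
          using w(2)[of 0] N b' by (simp add: leaf_zero)
      qed
      then have "\<exists>i<N. \<exists>j<d_cols n N h. w i j \<noteq> 0"
        using N by (intro exI[of _ 0]) simp
      then have "child N h i z j = w i j"
        using minimal_glue[OF N min w(1-3)] ij by blast
      then show ?thesis
        using w(4)[OF ij] by simp
    qed
    from p show ?thesis
    proof (cases rule: index_cases)
      case 1
      then show ?thesis using False by simp
    next
      case (2 i j)
      then show ?thesis
        using children[OF 2(1,2)] unfolding child_def by simp
    qed
  qed
  then show ?case
    unfolding minimal_bounded_def by blast
qed

end

section \<open>The matrices as balanced vectors\<close>

text \<open>
  The product of \<open>T\<^sub>s\<close> with the first coordinates of \<open>z\<close>, padded by zeros so that the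
  values lie in one abelian group for every \<open>l\<close>.
\<close>

definition row_values :: "(nat \<Rightarrow> int mat) \<Rightarrow> nat \<Rightarrow> nat \<Rightarrow> (nat \<Rightarrow> int) \<Rightarrow> nat \<Rightarrow> int" where
  "row_values T l s z = (\<lambda>r. if r < l then \<Sum>j<dim_col (T s). T s $$ (r, j) * z j else 0)"

interpretation multistage "\<lambda>i. dim_col (T i)" "row_values T l" for T l
proof
  fix s and a b :: "nat \<Rightarrow> int"
  show "row_values T l s (\<lambda>j. a j + b j) = row_values T l s a + row_values T l s b"
    by (auto simp: row_values_def algebra_simps sum.distrib)
  show "row_values T l s a = row_values T l s b" if "\<And>j. j < dim_col (T s) \<Longrightarrow> a j = b j"
    using that by (auto simp: row_values_def)
qed

lemma leaf_outside_rows: "\<not> r < l \<Longrightarrow> leaf T l N h z r = 0"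
  by (induction h arbitrary: z) (simp_all add: row_values_def)

text \<open>
  Block \<open>i\<close> of the product depends on block \<open>i\<close> of the vector only.
\<close>

lemma diag_block_mat_replicate_mult:
  fixes A :: "'a::semiring_1 mat"
  assumes A: "A \<in> carrier_mat m d" and "y \<in> carrier_vec (N * d)" "i < N" "p < m"
  shows "(diag_block_mat (replicate N A) *\<^sub>v y) $ (i * m + p) =
    (A *\<^sub>v vec d (\<lambda>j. y $ (i * d + j))) $ p"
  using assms(2-)
proof (induction N arbitrary: i y)
  case (Suc N)
  let ?B = "diag_block_mat (replicate N A)"
  have B: "?B \<in> carrier_mat (N * m) (N * d)"
    using A by (auto simp: dim_diag_block_mat sum_list_replicate)
  let ?y0 = "vec_first y d" and ?y1 = "vec_last y (N * d)"
  have y: "y = ?y0 @\<^sub>v ?y1"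
    using Suc.prems(1) by (intro vec_first_last_append[symmetric]) simp
  have "diag_block_mat (replicate (Suc N) A) =
      four_block_mat A (0\<^sub>m m (N * d)) (0\<^sub>m (N * m) d) ?B"
    by (simp only: replicate_Suc diag_block_mat.simps Let_def carrier_matD[OF A] carrier_matD[OF B])
  then have "diag_block_mat (replicate (Suc N) A) *\<^sub>v y =
      four_block_mat A (0\<^sub>m m (N * d)) (0\<^sub>m (N * m) d) ?B *\<^sub>v (?y0 @\<^sub>v ?y1)"
    by (simp only: y[symmetric])
  also have "\<dots> = (A *\<^sub>v ?y0 + 0\<^sub>m m (N * d) *\<^sub>v ?y1) @\<^sub>v (0\<^sub>m (N * m) d *\<^sub>v ?y0 + ?B *\<^sub>v ?y1)"
    by (rule four_block_mat_mult_vec[OF A _ _ B]) auto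
  also have "\<dots> = (A *\<^sub>v ?y0) @\<^sub>v (?B *\<^sub>v ?y1)"
    using A B by auto
  finally have split: "diag_block_mat (replicate (Suc N) A) *\<^sub>v y = (A *\<^sub>v ?y0) @\<^sub>v (?B *\<^sub>v ?y1)" .
  show ?case
  proof (cases i)
    case 0
    have "?y0 = vec d (\<lambda>j. y $ (i * d + j))"
      using Suc.prems(1) 0 by (auto simp: vec_first_def)
    then show ?thesis
      unfolding split using 0 Suc.prems(3) A B by simp
  next
    case i: (Suc i')
    have "i' < N" using Suc.prems(2) i by simp
    have "(?B *\<^sub>v ?y1) $ (i' * m + p) = (A *\<^sub>v vec d (\<lambda>j. ?y1 $ (i' * d + j))) $ p"
      by (rule Suc.IH) (use Suc.prems(3) \<open>i' < N\<close> in auto)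
    moreover have "vec d (\<lambda>j. ?y1 $ (i' * d + j)) = vec d (\<lambda>j. y $ (i * d + j))"
    proof (rule eq_vecI)
      fix j assume "j < dim_vec (vec d (\<lambda>j. y $ (i * d + j)))"
      then have "j < d" by simp
      then have "i' * d + j < Suc i' * d" by simp
      also have "\<dots> \<le> N * d"
        using \<open>i' < N\<close> by (intro mult_le_mono1) simp
      finally show "vec d (\<lambda>j. ?y1 $ (i' * d + j)) $ j = vec d (\<lambda>j. y $ (i * d + j)) $ j"
        using \<open>j < d\<close> Suc.prems(1) by (simp add: vec_last_def i algebra_simps)
    qed simp
    moreover have "i' * m + p < N * m"
    proof -
      have "i' * m + p < Suc i' * m" using Suc.prems(3) by simp
      also have "\<dots> \<le> N * m"
        using \<open>i' < N\<close> by (intro mult_le_mono1) simp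
      finally show ?thesis .
    qed
    ultimately show ?thesis
      unfolding split using i A B by simp
  qed
qed simp

text \<open>
  The matrix is to be treated as a unit; the rows of its product with a vector are computed once.
\<close>

declare A_mat.simps(2) [simp del]

text \<open>
  The rows of \<open>A\<^sub>h\<^sub>+\<^sub>1\<close> fall into \<open>N\<close> groups of \<open>N ^ h\<close> blocks of
  \<open>l\<close> rows; group \<open>i\<close> sees the root and child \<open>i\<close>.
\<close>

lemma A_mat_Suc_mult:
  fixes T :: "nat \<Rightarrow> int mat" and f :: "nat \<Rightarrow> int"
  defines "n \<equiv> \<lambda>i. dim_col (T i)"
  assumes T: "\<forall>s\<le>Suc h. dim_row (T s) = l"
    and i: "i < N" and q: "q < N ^ h" and r: "r < l"
  shows "(A_mat T N (Suc h) *\<^sub>v vec (d_cols n N (Suc h)) f) $ ((i * N ^ h + q) * l + r) =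
    row_values T l (Suc h) f r +
    (A_mat T N h *\<^sub>v vec (d_cols n N h) (child T N h i f)) $ (q * l + r)"
proof -
  let ?A = "A_mat T N h" and ?m = "N ^ h * l" and ?d = "d_cols n N h" and ?n = "n (Suc h)"
  let ?L = "vstack N (vstack (N ^ h) (T (Suc h)))" and ?D = "diag_block_mat (replicate N ?A)"
  let ?x = "vec ?n f" and ?y = "vec (N * ?d) (\<lambda>j. f (?n + j))" and ?p = "q * l + r"
  have A: "?A \<in> carrier_mat ?m ?d"
    unfolding n_def by (rule A_mat_carrier, rule carrier_matI) (use T in auto)
  have D: "?D \<in> carrier_mat (N * ?m) (N * ?d)"
    using A by (auto simp: dim_diag_block_mat sum_list_replicate)
  have L: "?L \<in> carrier_mat (N * ?m) ?n"
    using T by (auto simp: n_def)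
  have p: "?p < ?m"
  proof -
    have "?p < Suc q * l" using r by simp
    also have "\<dots> \<le> ?m" using q by (intro mult_le_mono1) simp
    finally show ?thesis .
  qed
  have row: "i * ?m + ?p < N * ?m"
  proof -
    have "i * ?m + ?p < Suc i * ?m" using p by simp
    also have "\<dots> \<le> N * ?m" using i by (intro mult_le_mono1) simp
    finally show ?thesis .
  qed
  have vec: "vec (d_cols n N (Suc h)) f = ?x @\<^sub>v ?y"
    by (rule eq_vecI) (auto simp: d_cols_Suc)
  have "A_mat T N (Suc h) *\<^sub>v vec (d_cols n N (Suc h)) f =
      four_block_mat ?L ?D (0\<^sub>m 0 ?n) (0\<^sub>m 0 (N * ?d)) *\<^sub>v (?x @\<^sub>v ?y)"
    by (simp only: vec A_mat.simps Let_def carrier_matD(2)[OF L] carrier_matD(2)[OF D])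
  also have "\<dots> = (?L *\<^sub>v ?x + ?D *\<^sub>v ?y) @\<^sub>v (0\<^sub>m 0 ?n *\<^sub>v ?x + 0\<^sub>m 0 (N * ?d) *\<^sub>v ?y)"
    by (rule four_block_mat_mult_vec[OF L D]) auto
  finally have "(A_mat T N (Suc h) *\<^sub>v vec (d_cols n N (Suc h)) f) $ (i * ?m + ?p) =
      (?L *\<^sub>v ?x) $ (i * ?m + ?p) + (?D *\<^sub>v ?y) $ (i * ?m + ?p)"
    using row L D by simp
  moreover have "(?L *\<^sub>v ?x) $ (i * ?m + ?p) = row_values T l (Suc h) f r"
  proof -
    have "(i * ?m + ?p) mod ?m = ?p"
      using p by simp
    then have "?L $$ (i * ?m + ?p, j) = T (Suc h) $$ (r, j)" if "j < ?n" for j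
      using that row p r T by (simp add: vstack_def n_def)
    then show ?thesis
      using row r T by (auto simp: row_values_def scalar_prod_def n_def atLeast0LessThan intro!: sum.cong)
  qed
  moreover have "(?D *\<^sub>v ?y) $ (i * ?m + ?p) = (?A *\<^sub>v vec ?d (child T N h i f)) $ ?p"
  proof -
    have "vec ?d (\<lambda>j. ?y $ (i * ?d + j)) = vec ?d (child T N h i f)"
    proof (rule eq_vecI)
      fix j assume "j < dim_vec (vec ?d (child T N h i f))"
      then have "j < ?d" by simp
      then have "i * ?d + j < Suc i * ?d" by simp
      also have "\<dots> \<le> N * ?d"
        using i by (intro mult_le_mono1) simp
      finally show "vec ?d (\<lambda>j. ?y $ (i * ?d + j)) $ j = vec ?d (child T N h i f) $ j"
        using \<open>j < ?d\<close> by (simp add: child_def n_def add.assoc)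
    qed simp
    then show ?thesis
      using diag_block_mat_replicate_mult[OF A _ i p, of ?y] by simp
  qed
  moreover have "(i * N ^ h + q) * l + r = i * ?m + ?p"
    by (simp add: algebra_simps)
  ultimately show ?thesis by (simp only:)
qed

text \<open>
  Each block of \<open>l\<close> rows belongs to one leaf and computes its path sum.  An arbitrary
  common value \<open>c\<close> is allowed because the children of a kernel vector have path sums
  other than \<open>0\<close>.
\<close>

lemma A_mat_rows_iff:
  fixes T :: "nat \<Rightarrow> int mat" and f :: "nat \<Rightarrow> int"
  defines "n \<equiv> \<lambda>i. dim_col (T i)"
  assumes "1 \<le> N" and "\<forall>s\<le>h. dim_row (T s) = l"
  shows "(\<forall>q<N ^ h. \<forall>r<l. (A_mat T N h *\<^sub>v vec (d_cols n N h) f) $ (q * l + r) = c r) \<longleftrightarrow>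
    balanced T l N h f \<and> (\<forall>r<l. leaf T l N h f r = c r)"
  using assms(3)
proof (induction h arbitrary: f c)
  case 0
  have "(T 0 *\<^sub>v vec (n 0) f) $ r = row_values T l 0 f r" if "r < l" for r
    using 0 that
    by (auto simp: n_def row_values_def scalar_prod_def atLeast0LessThan intro!: sum.cong)
  then show ?case by simp
next
  case (Suc h)
  let ?c = "\<lambda>r. c r - row_values T l (Suc h) f r"
  let ?v = "\<lambda>i. A_mat T N h *\<^sub>v vec (d_cols n N h) (child T N h i f)"
  let ?w = "A_mat T N (Suc h) *\<^sub>v vec (d_cols n N (Suc h)) f"
  have "(\<forall>q<N ^ Suc h. \<forall>r<l. ?w $ (q * l + r) = c r) \<longleftrightarrow>
      (\<forall>i<N. \<forall>q<N ^ h. \<forall>r<l. ?w $ ((i * N ^ h + q) * l + r) = c r)"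
  proof safe
    fix i q r assume *: "\<forall>q<N ^ Suc h. \<forall>r<l. ?w $ (q * l + r) = c r" "i < N" "q < N ^ h" "r < l"
    have "i * N ^ h + q < Suc i * N ^ h" using *(3) by simp
    also have "\<dots> \<le> N ^ Suc h"
      using *(2) unfolding power_Suc by (intro mult_le_mono1) simp
    finally show "?w $ ((i * N ^ h + q) * l + r) = c r"
      using * by blast
  next
    fix q r assume *: "\<forall>i<N. \<forall>q<N ^ h. \<forall>r<l. ?w $ ((i * N ^ h + q) * l + r) = c r"
      "q < N ^ Suc h" "r < l"
    have "q div N ^ h < N" "q mod N ^ h < N ^ h"
      using *(2) assms(2) by (auto simp: less_mult_imp_div_less)
    then have "?w $ ((q div N ^ h * N ^ h + q mod N ^ h) * l + r) = c r"
      using *(1,3) by blast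
    then show "?w $ (q * l + r) = c r"
      by (simp only: div_mult_mod_eq)
  qed
  also have "\<dots> \<longleftrightarrow> (\<forall>i<N. \<forall>q<N ^ h. \<forall>r<l. ?v i $ (q * l + r) = ?c r)"
  proof -
    have "?w $ ((i * N ^ h + q) * l + r) = c r \<longleftrightarrow> ?v i $ (q * l + r) = ?c r"
      if "i < N" "q < N ^ h" "r < l" for i q r
      using A_mat_Suc_mult[OF Suc.prems that, of f] unfolding n_def by auto
    then show ?thesis by blast
  qed
  also have "\<dots> \<longleftrightarrow> (\<forall>i<N. balanced T l N h (child T N h i f) \<and>
      (\<forall>r<l. leaf T l N h (child T N h i f) r = ?c r))"
  proof -
    have "(\<forall>q<N ^ h. \<forall>r<l. ?v i $ (q * l + r) = ?c r) \<longleftrightarrow> balanced T l N h (child T N h i f) \<and>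
      (\<forall>r<l. leaf T l N h (child T N h i f) r = ?c r)" for i
      using Suc.IH Suc.prems by simp
    then show ?thesis by simp
  qed
  also have "\<dots> \<longleftrightarrow> balanced T l N (Suc h) f \<and> (\<forall>r<l. leaf T l N (Suc h) f r = c r)"
  proof
    assume *: "\<forall>i<N. balanced T l N h (child T N h i f) \<and>
      (\<forall>r<l. leaf T l N h (child T N h i f) r = ?c r)"
    have "leaf T l N h (child T N h i f) = (\<lambda>r. if r < l then ?c r else 0)" if "i < N" for i
      using * that leaf_outside_rows by fastforce
    then have "balanced T l N (Suc h) f"
      using * by (intro balanced_SucI) blast+
    then show "balanced T l N (Suc h) f \<and> (\<forall>r<l. leaf T l N (Suc h) f r = c r)"
      using * assms(2) by simp
  next
    assume *: "balanced T l N (Suc h) f \<and> (\<forall>r<l. leaf T l N (Suc h) f r = c r)"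
    show "\<forall>i<N. balanced T l N h (child T N h i f) \<and>
      (\<forall>r<l. leaf T l N h (child T N h i f) r = ?c r)"
    proof (intro allI impI conjI)
      fix i assume i: "i < N"
      show "balanced T l N h (child T N h i f)"
        using balanced_SucD(1)[OF _ i] * by blast
      fix r assume "r < l"
      then show "leaf T l N h (child T N h i f) r = ?c r"
        unfolding balanced_SucD(2)[OF conjunct1[OF *] i] using * by (simp add: algebra_simps)
    qed
  qed
  finally show ?case .
qed

lemma mat_kernel_A_mat_iff:
  fixes T :: "nat \<Rightarrow> int mat" and f :: "nat \<Rightarrow> int"
  assumes "1 \<le> N" and T: "\<forall>s\<le>h. dim_row (T s) = l"
  shows "vec (d_cols (\<lambda>i. dim_col (T i)) N h) f \<in> mat_kernel (A_mat T N h) \<longleftrightarrow>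
    leaf_kernel T l h N f"
proof -
  let ?d = "d_cols (\<lambda>i. dim_col (T i)) N h" and ?A = "A_mat T N h"
  have A: "?A \<in> carrier_mat (N ^ h * l) ?d"
    by (rule A_mat_carrier, rule carrier_matI) (use T in auto)
  have "vec ?d f \<in> mat_kernel ?A \<longleftrightarrow> ?A *\<^sub>v vec ?d f = 0\<^sub>v (N ^ h * l)"
    unfolding mat_kernel[OF A] by simp
  also have "\<dots> \<longleftrightarrow> (\<forall>q<N ^ h. \<forall>r<l. (?A *\<^sub>v vec ?d f) $ (q * l + r) = 0)"
  proof
    assume *: "?A *\<^sub>v vec ?d f = 0\<^sub>v (N ^ h * l)"
    show "\<forall>q<N ^ h. \<forall>r<l. (?A *\<^sub>v vec ?d f) $ (q * l + r) = 0"
    proof (intro allI impI)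
      fix q r assume "q < N ^ h" "r < l"
      have "q * l + r < Suc q * l" using \<open>r < l\<close> by simp
      also have "\<dots> \<le> N ^ h * l" using \<open>q < N ^ h\<close> by (intro mult_le_mono1) simp
      finally show "(?A *\<^sub>v vec ?d f) $ (q * l + r) = 0"
        unfolding * by simp
    qed
  next
    assume *: "\<forall>q<N ^ h. \<forall>r<l. (?A *\<^sub>v vec ?d f) $ (q * l + r) = 0"
    show "?A *\<^sub>v vec ?d f = 0\<^sub>v (N ^ h * l)"
    proof (rule eq_vecI)
      fix p assume "p < dim_vec (0\<^sub>v (N ^ h * l) :: int vec)"
      then have p: "p < N ^ h * l" by simp
      then have "p div l < N ^ h" "p mod l < l"
        by (auto simp: less_mult_imp_div_less intro!: mod_less_divisor gr0I)
      then have "(?A *\<^sub>v vec ?d f) $ (p div l * l + p mod l) = 0"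
        using * by blast
      then show "(?A *\<^sub>v vec ?d f) $ p = 0\<^sub>v (N ^ h * l) $ p"
        using p by simp
    qed (use A in simp)
  qed
  also have "\<dots> \<longleftrightarrow> balanced T l N h f \<and> (\<forall>r<l. leaf T l N h f r = 0)"
    using A_mat_rows_iff[OF assms, where f = f and c = "\<lambda>_. 0"] by simp
  also have "(\<forall>r<l. leaf T l N h f r = 0) \<longleftrightarrow> leaf T l N h f = 0"
    using leaf_outside_rows[of _ l T N h f] unfolding fun_eq_iff zero_fun_apply by blast
  also have "balanced T l N h f \<and> leaf T l N h f = 0 \<longleftrightarrow> leaf_kernel T l h N f"
    unfolding leaf_kernel_def ..
  finally show ?thesis .
qed

section \<open>Graver bases and their building blocks\<close>

lemma Graver_basis_conformal_minimal:
  fixes T :: "nat \<Rightarrow> int mat"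
  assumes N: "1 \<le> N" and T: "\<forall>s\<le>h. dim_row (T s) = l"
    and z: "z \<in> Graver_basis (A_mat T N h)"
  shows "z \<in> carrier_vec (d_cols (\<lambda>i. dim_col (T i)) N h)"
    and "conformal_minimal {..<d_cols (\<lambda>i. dim_col (T i)) N h} (leaf_kernel T l h N) (($) z)"
proof -
  let ?d = "d_cols (\<lambda>i. dim_col (T i)) N h" and ?A = "A_mat T N h"
  have A: "?A \<in> carrier_mat (N ^ h * l) ?d"
    by (rule A_mat_carrier, rule carrier_matI) (use T in auto)
  have zker: "z \<in> mat_kernel ?A" and z0: "z \<noteq> 0\<^sub>v ?d"
    and zmin: "\<And>w. w \<in> mat_kernel ?A \<Longrightarrow> w \<noteq> 0\<^sub>v ?d \<Longrightarrow> w \<sqsubseteq>\<^sub>c z \<Longrightarrow> w = z"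
    using z A unfolding Graver_basis_def by auto
  show zc: "z \<in> carrier_vec ?d"
    using mat_kernelD(1)[OF A zker] .
  have vec: "vec ?d (($) z) = z"
    using zc by auto
  show "conformal_minimal {..<?d} (leaf_kernel T l h N) (($) z)"
    unfolding conformal_minimal_def
  proof (intro conjI allI impI)
    show "leaf_kernel T l h N (($) z)"
      using mat_kernel_A_mat_iff[OF N T, where f = "($) z"] zker vec by simp
    show "\<exists>j\<in>{..<?d}. z $ j \<noteq> 0"
    proof (rule ccontr)
      assume "\<not> ?thesis"
      then have "z = 0\<^sub>v ?d"
        using zc by (intro eq_vecI) auto
      then show False using z0 by contradiction
    qed
    fix w assume w: "leaf_kernel T l h N w \<and> (\<exists>j\<in>{..<?d}. w j \<noteq> 0) \<and> conformal_on {..<?d} w (($) z)"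
    have "vec ?d w = z"
    proof (rule zmin)
      show "vec ?d w \<in> mat_kernel ?A"
        using mat_kernel_A_mat_iff[OF N T, where f = w] w by simp
      show "vec ?d w \<noteq> 0\<^sub>v ?d"
      proof
        assume "vec ?d w = 0\<^sub>v ?d"
        then have "vec ?d w $ j = 0" if "j < ?d" for j
          using that by simp
        then show False
          using w by auto
      qed
      show "vec ?d w \<sqsubseteq>\<^sub>c z"
        using w zc unfolding conformal_le_def conformal_on_def by auto
    qed
    then show "\<forall>j\<in>{..<?d}. w j = z $ j"
      by auto
  qed
qed

lemma finite_bounded_vec: "finite {v \<in> carrier_vec m. \<forall>j<m. \<bar>v $ j\<bar> \<le> (c :: int)}"
proof (rule finite_subset)
  show "finite (vec m ` ({..<m} \<rightarrow>\<^sub>E {-c..c}))"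
    by (simp add: finite_PiE)
  show "{v \<in> carrier_vec m. \<forall>j<m. \<bar>v $ j\<bar> \<le> c} \<subseteq> vec m ` ({..<m} \<rightarrow>\<^sub>E {-c..c})"
  proof
    fix v assume v: "v \<in> {v \<in> carrier_vec m. \<forall>j<m. \<bar>v $ j\<bar> \<le> c}"
    have "v = vec m (restrict (($) v) {..<m})"
      using v by (intro eq_vecI) auto
    moreover have "- c \<le> v $ j \<and> v $ j \<le> c" if "j < m" for j
    proof -
      have "\<bar>v $ j\<bar> \<le> c" using v that by simp
      then show ?thesis by linarith
    qed
    then have "restrict (($) v) {..<m} \<in> {..<m} \<rightarrow>\<^sub>E {-c..c}"
      by (simp add: PiE_iff)
    ultimately show "v \<in> vec m ` ({..<m} \<rightarrow>\<^sub>E {-c..c})"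
      by (rule image_eqI)
  qed
qed

text \<open>
  A block is a segment of \<open>z\<close>, so it inherits a bound for the entries.
\<close>

lemma block_bounded:
  assumes "set \<alpha> \<subseteq> {1..N}" "length \<alpha> \<le> h" "z \<in> carrier_vec (d_cols n N h)"
    "\<And>j. j < d_cols n N h \<Longrightarrow> \<bar>z $ j\<bar> \<le> c"
  shows "block n N h \<alpha> z \<in>
    {v \<in> carrier_vec (n (h - length \<alpha>)). \<forall>j<n (h - length \<alpha>). \<bar>v $ j\<bar> \<le> c}"
  using assms
proof (induction \<alpha> arbitrary: h z)
  case Nil
  have "n h \<le> d_cols n N h"
    by (cases h) (simp_all add: d_cols_Suc)
  then show ?case
    using Nil.prems by (simp add: vec_first_def)
next
  case (Cons i \<alpha>)
  obtain h' where h: "h = Suc h'"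
    using Cons.prems(2) by (cases h) auto
  have i: "i - 1 < N"
    using Cons.prems(1) by auto
  have idx: "n (Suc h') + (i - 1) * d_cols n N h' + j < d_cols n N (Suc h')"
    if "j < d_cols n N h'" for j
  proof -
    have "(i - 1) * d_cols n N h' + j < Suc (i - 1) * d_cols n N h'"
      using that by simp
    also have "\<dots> \<le> N * d_cols n N h'"
      using i by (intro mult_le_mono1) simp
    finally show ?thesis
      by (simp add: d_cols_Suc)
  qed
  show ?case
    unfolding h block.simps length_Cons diff_Suc_Suc
    by (rule Cons.IH) (use Cons.prems idx in \<open>auto simp: h\<close>)
qed

theorem proposition8p11:
  fixes k l :: nat and n :: "nat \<Rightarrow> nat" and T :: "nat \<Rightarrow> int mat"
  assumes "l \<ge> 1"
    and "\<And>s. s \<le> k \<Longrightarrow> n s \<ge> 1"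
    and "\<And>s. s \<le> k \<Longrightarrow> T s \<in> carrier_mat l (n s)"
  shows "finite (H_inf T k)"
proof -
  have T: "\<forall>s\<le>k. dim_row (T s) = l"
    using assms(3) by auto
  let ?n = "\<lambda>i. dim_col (T i)"
  obtain C0 where "minimal_bounded T k (\<lambda>N. balanced T l N k) C0"
    using balanced_minimal_bounded by blast
  then obtain C where C: "minimal_bounded T k (leaf_kernel T l k) C"
    using kernel_minimal_bounded by blast
  have "finite (H_level T k s)" if s: "s \<le> k" for s
  proof (rule finite_subset)
    let ?V = "{v \<in> carrier_vec (?n (k - s)). \<forall>j<?n (k - s). \<bar>v $ j\<bar> \<le> int C}"
    show "finite ?V"
      by (rule finite_bounded_vec)
    show "H_level T k s \<subseteq> ?V"
    proof
      fix v assume "v \<in> H_level T k s"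
      then obtain N z \<alpha> where N: "1 \<le> N" and z: "z \<in> Graver_basis (A_mat T N k)"
        and \<alpha>: "set \<alpha> \<subseteq> {1..N}" "length \<alpha> = s" and v: "v = block ?n N k \<alpha> z"
        unfolding H_level_def H_fin_def by auto
      note gz = Graver_basis_conformal_minimal[OF N T z]
      have "\<bar>z $ j\<bar> \<le> int C" if "j < d_cols ?n N k" for j
        using C N gz(2) that unfolding minimal_bounded_def by blast
      then show "v \<in> ?V"
        using block_bounded[OF \<alpha>(1) _ gz(1), of "int C"] \<alpha>(2) s unfolding v by simp
    qed
  qed
  then show ?thesis
    unfolding H_inf_def by (intro finite_SigmaI) simp_all
qed

end
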